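(* Let $T>0$, $d,m\ge 1$, $H\in(\tfrac12,1)$, and let $W^H=(W^{H,1},\dots,W^{H,m})$ be an $m$-tuple of independent fractional Brownian motions with Hurst parameter $H$ (with continuous paths) defined on a complete probability space $(\Omega,\mathcal F,\mathbb P)$. Let $x(0)\in\mathbb R^d$ with $x^i(0)>0$ for $i=1,\dots,d$. Let $\sigma:[0,T]\times\mathbb R^d\to\mathbb R^{d\times m}$ and $b:[0,T]\times\mathbb R^d\to\mathbb R^d$ be bounded, and suppose there are constants $K_0\ge 0$ and $\nu\ge H$ such that for all $x,y\in\mathbb R^d$ and all $s,t\in[0,T]$: $$|\sigma(t,x)-\sigma(t,y)|\le K_0|x-y|,\qquad |\sigma(t,x)-\sigma(s,x)|\le K_0|t-s|^{\nu},\qquad |b(t,x)-b(t,y)|\le K_0|x-y|.$$ Let $\lambda_0\in(\tfrac12,H)$. If $X\in L^0\big(\Omega,\mathcal F,\mathbb P;C^{\lambda_0}(0,T;\mathbb R^d)\big)$ is a solution of the stochastic differential equation with reflection $$X(t)=x(0)+\int_0^t b(s,X(s))\,ds+\int_0^t\sigma(s,X(s))\,dW^H_s+Y(t),\qquad t\in(0,T],\qquad X(0)=x(0),$$ where $$Y^i(t)=\max_{s\in[0,t]}\big(Z^i(s)\big)^-\ (i=1,\dots,d),\qquad Z(t)=x(0)+\int_0^t b(s,X(s))\,ds+\int_0^t\sigma(s,X(s))\,dW^H_s,\qquad t\in[0,T],$$ then $$E\big(\|X\|_{\lambda_0,[0,T]}^p\big)<\infty\qquad\text{for all } p\ge1.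$$
   Context: For $0<\lambda\le1$, $C^{\lambda}(s,t;\mathbb R^d)$ is the space of functions $f:[s,t]\to\mathbb R^d$ with $\|f\|_{\lambda,[s,t]}:=\sup_{s\le u<v\le t}\frac{|f(v)-f(u)|}{(v-u)^\lambda}<\infty$. For real $a$, $a^-=\max(-a,0)$. $L^0(\Omega,\mathcal F,\mathbb P;E)$ denotes the set of $E$-valued random variables. The integral with respect to $W^H$ is understood pathwise (almost surely) as a Young integral, i.e. the limit of Riemann–Stieltjes sums as the mesh tends to zero, which exists when the integrand is $\lambda$-Hölder and the integrator is $\gamma$-Hölder with $\lambda+\gamma>1$; almost surely, the paths of $W^H$ are $\gamma$-Hölder on $[0,T]$ for every $\gamma<H$. A solution in $L^0(\Omega,\mathcal F,\mathbb P;C^{\lambda_0}(0,T;\mathbb R^d))$ is such a random variable $X$ for which, almost surely, $s\mapsto b(s,X(s))$ is Lebesgue integrable on $[0,T]$ and the displayed equation holds for all $t\in[0,T]$. *)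

theory Defs
  imports "HOL-Probability.Probability"
begin

section \<open>Hoelder seminorm\<close>

definition holder_quotients :: "real \<Rightarrow> real \<Rightarrow> real \<Rightarrow> (real \<Rightarrow> 'b::real_normed_vector) \<Rightarrow> real set"
  where "holder_quotients \<alpha> s t f =
    {norm (f v - f u) / (v - u) powr \<alpha> | u v. s \<le> u \<and> u < v \<and> v \<le> t}"

definition holder_space :: "real \<Rightarrow> real \<Rightarrow> real \<Rightarrow> (real \<Rightarrow> 'b::real_normed_vector) set"
  where "holder_space \<alpha> s t = {f. bdd_above (holder_quotients \<alpha> s t f)}"

text \<open>Only meaningful for \<open>s < t\<close> and functions in \<^const>\<open>holder_space\<close>,
  where the real supremum is that of a nonempty bounded set.\<close>

definition holder_seminorm :: "real \<Rightarrow> real \<Rightarrow> real \<Rightarrow> (real \<Rightarrow> 'b::real_normed_vector) \<Rightarrow> real"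
  where "holder_seminorm \<alpha> s t f = Sup (holder_quotients \<alpha> s t f)"

section \<open>Fractional Brownian motion\<close>

text \<open>Almost surely constant variables count as (degenerate) Gaussian ones.\<close>

definition gaussian_variable :: "'a measure \<Rightarrow> ('a \<Rightarrow> real) \<Rightarrow> bool"
  where "gaussian_variable M X \<longleftrightarrow> X \<in> borel_measurable M \<and>
    ((\<exists>\<mu>. AE \<omega> in M. X \<omega> = \<mu>) \<or>
     (\<exists>\<mu> s. s > 0 \<and> distributed M lborel X (\<lambda>x. ennreal (normal_density \<mu> s x))))"

definition gaussian_process :: "'a measure \<Rightarrow> real set \<Rightarrow> (real \<Rightarrow> 'a \<Rightarrow> real) \<Rightarrow> bool"
  where "gaussian_process M I B \<longleftrightarrow>
    (\<forall>J c. finite J \<and> J \<subseteq> I \<longrightarrow> gaussian_variable M (\<lambda>\<omega>. \<Sum>t\<in>J. c t * B t \<omega>))"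

text \<open>Fractional Brownian motion with time set \<open>I\<close>; continuity of the paths is not part of
  the definition.\<close>

definition fractional_brownian_motion ::
    "'a measure \<Rightarrow> real set \<Rightarrow> real \<Rightarrow> (real \<Rightarrow> 'a \<Rightarrow> real) \<Rightarrow> bool"
  where "fractional_brownian_motion M I H B \<longleftrightarrow>
    gaussian_process M I B \<and>
    (\<forall>t\<in>I. integral\<^sup>L M (B t) = 0) \<and>
    (\<forall>s\<in>I. \<forall>t\<in>I. integral\<^sup>L M (\<lambda>\<omega>. B s \<omega> * B t \<omega>) =
       (s powr (2 * H) + t powr (2 * H) - \<bar>t - s\<bar> powr (2 * H)) / 2)"

text \<open>The components are independent as processes, i.e. as random elements of the product space
  over the time set \<open>I\<close>.\<close>

definition independent_components ::
    "'a measure \<Rightarrow> real set \<Rightarrow> (real \<Rightarrow> 'a \<Rightarrow> real^'m) \<Rightarrow> bool"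
  where "independent_components M I W \<longleftrightarrow>
    prob_space.indep_vars M (\<lambda>_. PiM I (\<lambda>_. borel)) (\<lambda>j \<omega>. \<lambda>t\<in>I. W t \<omega> $ j) UNIV"

section \<open>Young integral\<close>

text \<open>In a tagged division each \<open>K\<close> is a compact interval \<open>[Inf K, Sup K]\<close>; degenerate intervals
  contribute nothing to the sum.\<close>

definition stieltjes_sum ::
    "(real \<Rightarrow> real^'m^'d) \<Rightarrow> (real \<Rightarrow> real^'m) \<Rightarrow> (real \<times> real set) set \<Rightarrow> real^'d"
  where "stieltjes_sum f g D = (\<Sum>(\<xi>, K)\<in>D. f \<xi> *v (g (Sup K) - g (Inf K)))"

definition has_young_integral ::
    "(real \<Rightarrow> real^'m^'d) \<Rightarrow> (real \<Rightarrow> real^'m) \<Rightarrow> real^'d \<Rightarrow> real \<Rightarrow> real \<Rightarrow> bool"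
  where "has_young_integral f g J a b \<longleftrightarrow>
    (\<forall>\<epsilon>>0. \<exists>\<delta>>0. \<forall>D. D tagged_division_of {a..b} \<and> (\<forall>(\<xi>, K)\<in>D. Sup K - Inf K < \<delta>) \<longrightarrow>
       norm (stieltjes_sum f g D - J) < \<epsilon>)"

text \<open>Unspecified if the Riemann--Stieltjes sums do not converge.\<close>

definition young_integral ::
    "real \<Rightarrow> real \<Rightarrow> (real \<Rightarrow> real^'m^'d) \<Rightarrow> (real \<Rightarrow> real^'m) \<Rightarrow> real^'d"
  where "young_integral a b f g = (THE J. has_young_integral f g J a b)"

section \<open>The reflected equation\<close>

text \<open>The process \<open>Z\<close>, computed from a path \<open>x\<close> of \<open>X\<close> and a path \<open>w\<close> of the driver.\<close>

definition unreflected_path ::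
    "real^'d \<Rightarrow> (real \<Rightarrow> real^'d \<Rightarrow> real^'d) \<Rightarrow> (real \<Rightarrow> real^'d \<Rightarrow> real^'m^'d) \<Rightarrow>
     (real \<Rightarrow> real^'m) \<Rightarrow> (real \<Rightarrow> real^'d) \<Rightarrow> real \<Rightarrow> real^'d"
  where "unreflected_path x0 b \<sigma> w x t =
    x0 + (LINT s:{0..t}|lebesgue. b s (x s)) + young_integral 0 t (\<lambda>s. \<sigma> s (x s)) w"

text \<open>The process \<open>Y\<close>; for continuous \<open>z\<close> the supremum is a maximum.\<close>

definition regulator :: "(real \<Rightarrow> real^'d) \<Rightarrow> real \<Rightarrow> real^'d"
  where "regulator z t = (\<chi> i. SUP s\<in>{0..t}. max (- (z s $ i)) 0)"

text \<open>The \<open>\<sigma>\<close>-algebra on the space of Hoelder paths is the one generated by the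
  evaluations. It is contained in the Borel \<open>\<sigma>\<close>-algebra of the Hoelder norm
  \<open>norm (f 0) + holder_seminorm \<alpha> 0 T f\<close>.\<close>

definition holder_random_variable ::
    "'a measure \<Rightarrow> real \<Rightarrow> real \<Rightarrow> (real \<Rightarrow> 'a \<Rightarrow> real^'d) \<Rightarrow> bool"
  where "holder_random_variable M \<alpha> T X \<longleftrightarrow>
    (\<forall>t\<in>{0..T}. X t \<in> borel_measurable M) \<and>
    (\<forall>\<omega>\<in>space M. (\<lambda>t. X t \<omega>) \<in> holder_space \<alpha> 0 T)"

definition reflected_sde_solution ::
    "'a measure \<Rightarrow> real \<Rightarrow> real \<Rightarrow> real^'d \<Rightarrow> (real \<Rightarrow> real^'d \<Rightarrow> real^'d) \<Rightarrow>
     (real \<Rightarrow> real^'d \<Rightarrow> real^'m^'d) \<Rightarrow> (real \<Rightarrow> 'a \<Rightarrow> real^'m) \<Rightarrow>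
     (real \<Rightarrow> 'a \<Rightarrow> real^'d) \<Rightarrow> bool"
  where "reflected_sde_solution M T \<alpha> x0 b \<sigma> W X \<longleftrightarrow>
    holder_random_variable M \<alpha> T X \<and>
    (AE \<omega> in M.
       set_integrable lebesgue {0..T} (\<lambda>s. b s (X s \<omega>)) \<and>
       X 0 \<omega> = x0 \<and>
       (\<forall>t\<in>{0..T}. let Z = unreflected_path x0 b \<sigma> (\<lambda>s. W s \<omega>) (\<lambda>s. X s \<omega>)
          in X t \<omega> = Z t + regulator Z t))"

end

theory Submission
  imports Defs
begin

text \<open>
  Pathwise, Young's inequality on a short interval bounds the increment of \<open>Z\<close> by a term of order
  \<open>1 + G\<close>, where \<open>G\<close> is a \<open>\<gamma>\<close>-Hoelder constant of the driver with \<open>\<alpha> < \<gamma> < H\<close>, plus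
  \<open>G * \<Delta> powr \<gamma>\<close> times the Hoelder constant of \<open>X\<close> at scale \<open>\<Delta>\<close>; the regulator at most multiplies
  these by a dimensional constant. Choosing \<open>\<Delta>\<close> of order \<open>(1 + G) powr (- 1 / \<gamma>)\<close> absorbs the last term, and
  chaining the \<open>T / \<Delta>\<close> short intervals gives \<open>holder_seminorm \<le> C * (1 + G) ^ 3\<close> with a deterministic
  \<open>C\<close>, because \<open>1 / \<gamma> \<le> 2\<close>. Kolmogorov's dyadic argument and the Gaussian moments of the increments of fractional
  Brownian motion show that \<open>G\<close> has moments of all orders.
\<close>

section \<open>Hoelder bounds\<close>

text \<open>Boundedness of \<open>b\<close> and \<open>\<sigma>\<close> makes the increment bound on
  a short interval independent of the value of the path at its left end. Chaining therefore adds
  local estimates instead of compounding them, which keeps the final bound polynomial in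
  \<open>G\<close>, so that moments of \<open>G\<close> suffice. The obstacle is that absorption
  needs a Young remainder on \<open>[u, v]\<close> carrying the Hoelder constant of \<open>X\<close>
  on \<open>[u, v]\<close> only, whereas the equation contains integrals that start at 0. An
  additive function sewn on \<open>[u, v]\<close> from the local constant and one sewn on the whole
  interval both have the limit of the Riemann-Stieltjes sums over \<open>[u, v]\<close> as
  increment. Uniqueness of that limit transfers the local estimate to the integral from 0; the
  global constant serves existence. The room on both sides of \<gamma> has separate uses: \<gamma> <
  H makes the series in Kolmogorov's argument converge once the moment order is high, and \<alpha> <
  \<gamma> lets \<open>(v - u) powr \<gamma>\<close> be traded for
  \<open>(v - u) powr \<alpha>\<close> at the cost of a power of \<open>T\<close>.\<close>

definition holder_bound :: "real \<Rightarrow> real \<Rightarrow> real \<Rightarrow> real \<Rightarrow> (real \<Rightarrow> 'b::real_normed_vector) \<Rightarrow> bool"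
  where "holder_bound \<alpha> a b F f \<longleftrightarrow>
    (\<forall>u v. a \<le> u \<longrightarrow> u \<le> v \<longrightarrow> v \<le> b \<longrightarrow> norm (f v - f u) \<le> F * (v - u) powr \<alpha>)"

lemma holder_boundD:
  "holder_bound \<alpha> a b F f \<Longrightarrow> a \<le> u \<Longrightarrow> u \<le> v \<Longrightarrow> v \<le> b \<Longrightarrow> norm (f v - f u) \<le> F * (v - u) powr \<alpha>"
  by (auto simp: holder_bound_def)

lemma holder_bound_abs:
  assumes "holder_bound \<alpha> a b F f" "u \<in> {a..b}" "v \<in> {a..b}"
  shows "norm (f v - f u) \<le> F * \<bar>v - u\<bar> powr \<alpha>"
proof (cases "u \<le> v")
  case True
  then show ?thesis using holder_boundD[OF assms(1), of u v] assms by auto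
next
  case False
  then show ?thesis using holder_boundD[OF assms(1), of v u] assms by (auto simp: norm_minus_commute abs_if)
qed

lemma holder_bound_subset:
  "holder_bound \<alpha> a b F f \<Longrightarrow> a \<le> a' \<Longrightarrow> b' \<le> b \<Longrightarrow> holder_bound \<alpha> a' b' F f"
  by (auto simp: holder_bound_def)

text \<open>On a degenerate interval the condition reduces to 0 \<le> 0, because
  \<open>0 powr \<alpha> = 0\<close>, and leaves the sign of \<open>F\<close> open; hence
  \<open>a < b\<close>.\<close>

lemma holder_bound_nonneg:
  assumes "holder_bound \<alpha> a b F f" "a < b" shows "0 \<le> F"
proof -
  have "0 \<le> F * (b - a) powr \<alpha>"
    using holder_boundD[OF assms(1), of a b] assms(2) norm_ge_zero order_trans by (metis order.refl less_imp_le)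
  then show ?thesis using assms(2) by (simp add: zero_le_mult_iff)
qed

lemma holder_seminorm_le:
  assumes "s < t" "holder_bound \<alpha> s t C f"
  shows "holder_seminorm \<alpha> s t f \<le> C"
  unfolding holder_seminorm_def
proof (rule cSup_least)
  show "holder_quotients \<alpha> s t f \<noteq> {}" using assms(1) by (auto simp: holder_quotients_def)
  fix x assume "x \<in> holder_quotients \<alpha> s t f"
  then obtain u v where "x = norm (f v - f u) / (v - u) powr \<alpha>" "s \<le> u" "u < v" "v \<le> t"
    by (auto simp: holder_quotients_def)
  then show "x \<le> C" using holder_boundD[OF assms(2), of u v] by (simp add: divide_le_eq)
qed

lemma holder_bound_of_holder_space:
  assumes "f \<in> holder_space \<alpha> s t"
  shows "holder_bound \<alpha> s t (holder_seminorm \<alpha> s t f) f"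
  unfolding holder_bound_def
proof (intro allI impI)
  fix u v assume uv: "s \<le> u" "u \<le> v" "v \<le> t"
  show "norm (f v - f u) \<le> holder_seminorm \<alpha> s t f * (v - u) powr \<alpha>"
  proof (cases "u = v")
    case False
    have "norm (f v - f u) / (v - u) powr \<alpha> \<in> holder_quotients \<alpha> s t f"
      unfolding holder_quotients_def mem_Collect_eq using uv False by (intro exI[of _ u] exI[of _ v]) auto
    then have "norm (f v - f u) / (v - u) powr \<alpha> \<le> holder_seminorm \<alpha> s t f"
      unfolding holder_seminorm_def using assms by (intro cSup_upper) (auto simp: holder_space_def)
    then show ?thesis using uv False by (simp add: divide_le_eq)
  qed simp
qed

lemma holder_bound_imp_continuous_on:
  fixes f :: "real \<Rightarrow> 'b::real_normed_vector"
  assumes f: "holder_bound \<alpha> a b F f" and \<alpha>: "\<alpha> > 0"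
  shows "continuous_on {a..b} f"
  unfolding continuous_on_def
proof
  fix u assume u: "u \<in> {a..b}"
  have "((\<lambda>v. F * \<bar>v - u\<bar> powr \<alpha>) \<longlongrightarrow> F * \<bar>u - u\<bar> powr \<alpha>) (at u within {a..b})"
    using \<alpha> by (intro tendsto_intros) auto
  then have "((\<lambda>v. F * \<bar>v - u\<bar> powr \<alpha>) \<longlongrightarrow> 0) (at u within {a..b})" by simp
  then have "((\<lambda>v. f v - f u) \<longlongrightarrow> 0) (at u within {a..b})"
    by (rule Lim_null_comparison[rotated]) (use holder_bound_abs[OF f u] in \<open>auto simp: eventually_at_filter\<close>)
  then show "(f \<longlongrightarrow> f u) (at u within {a..b})" by (simp add: LIM_zero_iff)
qed

section \<open>Sewing and the Young integral\<close>

text \<open>The norm on \<open>real^'m^'d\<close> is the Euclidean norm of the row norms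
  (Frobenius), so Cauchy-Schwarz in each row suffices.\<close>

lemma norm_matrix_vector_mult_le:
  fixes A :: "real^'m^'d"
  shows "norm (A *v x) \<le> norm A * norm x"
proof -
  have "norm (A *v x) = L2_set (\<lambda>i. norm ((A *v x) $ i)) UNIV"
    by (simp add: norm_vec_def)
  also have "\<dots> \<le> L2_set (\<lambda>i. norm (A $ i) * norm x) UNIV"
  proof (rule L2_set_mono)
    fix i show "norm ((A *v x) $ i) \<le> norm (A $ i) * norm x"
      by (simp add: matrix_vector_mul_component Cauchy_Schwarz_ineq2)
  qed simp
  also have "\<dots> = norm A * norm x"
    by (simp add: L2_set_left_distrib[symmetric] norm_vec_def[of A])
  finally show ?thesis .
qed

text \<open>Picks the dyadic level comparable to a given length. The upper bound keeps the number of
  cells that meet such an interval bounded; the lower bound turns powers of the mesh into powers of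
  the length.\<close>

lemma dyadic_scale:
  fixes d :: real
  assumes "0 < d" "d \<le> 1"
  obtains n where "1 / 2 ^ n \<le> d" "d < 2 / 2 ^ n"
proof -
  define n where "n = (LEAST n. 1 / 2 ^ n \<le> d)"
  have "\<exists>n. 1 / 2 ^ n \<le> d"
    using real_arch_pow_inv[OF assms(1), of "1/2"] by (auto simp: power_divide intro: less_imp_le)
  then have 1: "1 / 2 ^ n \<le> d" unfolding n_def by (rule LeastI_ex)
  have "d < 2 / 2 ^ n"
  proof (cases n)
    case 0 then show ?thesis using assms by simp
  next
    case (Suc m)
    then have "\<not> 1 / 2 ^ m \<le> d" using not_less_Least[of m "\<lambda>n. 1 / 2 ^ n \<le> d"] n_def by simp
    then show ?thesis using Suc by simp
  qed
  with 1 that show ?thesis by blast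
qed

text \<open>Cutting \<open>[u, v]\<close> at the multiples of \<open>h\<close> leaves at most
  \<open>2 + (v - u) / h\<close> pieces, each inside one cell. The grid is anchored at 0 and not at
  \<open>u\<close>, because dyadic sums have a simple form only within a cell of their own
  grid.\<close>

lemma norm_diff_cells_le:
  fixes p :: "real \<Rightarrow> 'b::real_normed_vector" and h u v \<beta> :: real
  assumes h: "h > 0" and u: "0 \<le> u" "u \<le> v"
    and cell: "\<And>(k::nat) x y. real k * h \<le> x \<Longrightarrow> x \<le> y \<Longrightarrow> y \<le> (real k + 1) * h \<Longrightarrow> u \<le> x \<Longrightarrow> y \<le> v
      \<Longrightarrow> norm (p y - p x) \<le> \<beta>"
  shows "norm (p v - p u) \<le> (2 + (v - u) / h) * \<beta>"
proof -
  define k where "k = nat \<lfloor>u / h\<rfloor>"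
  have k1: "real k * h \<le> u" and k2: "u \<le> (real k + 1) * h"
  proof -
    have "0 \<le> u / h" using u h by simp
    then have "real k \<le> u / h" "u / h \<le> real k + 1"
      unfolding k_def by linarith+
    then show "real k * h \<le> u" "u \<le> (real k + 1) * h" using h by (simp_all add: field_simps)
  qed
  have "0 \<le> \<beta>" using cell[of k u u] k1 k2 u norm_ge_zero[of "p u - p u"] by linarith
  have *: "norm (p w - p u) \<le> (real n + 1) * \<beta>" if "u \<le> w" "w \<le> v" "w \<le> (real k + 1 + real n) * h" for n w
    using that
  proof (induction n arbitrary: w)
    case 0
    then show ?case using cell[of k u w] k1 by simp
  next
    case (Suc n)
    show ?case
    proof (cases "w \<le> (real k + 1 + real n) * h")
      case True
      then have "norm (p w - p u) \<le> (real n + 1) * \<beta>" using Suc by blast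
      also have "\<dots> \<le> (real (Suc n) + 1) * \<beta>" using \<open>0 \<le> \<beta>\<close> by (intro mult_right_mono) auto
      finally show ?thesis .
    next
      case False
      define z where "z = (real k + 1 + real n) * h"
      have "u \<le> z" using k2 h unfolding z_def by (simp add: algebra_simps) (smt (verit) mult_nonneg_nonneg of_nat_0_le_iff)
      have "norm (p z - p u) \<le> (real n + 1) * \<beta>"
        using Suc.IH[of z] \<open>u \<le> z\<close> False Suc.prems unfolding z_def by simp
      moreover have "norm (p w - p z) \<le> \<beta>"
        using cell[of "k + 1 + n" z w] Suc.prems False \<open>u \<le> z\<close> unfolding z_def by (simp add: algebra_simps)
      ultimately have "norm (p w - p u) \<le> (real n + 1) * \<beta> + \<beta>"
        using norm_triangle_ineq[of "p w - p z" "p z - p u"] by simp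
      then show ?thesis by (simp add: algebra_simps)
    qed
  qed
  \<comment> \<open>The cell containing \<open>u\<close> ends at \<open>(k + 1) * h\<close>, at or
    after \<open>u\<close>; \<open>n\<close> further cells reach \<open>v\<close>. This gives
    \<open>n + 1\<close> pieces, and rounding up costs the second unit in
    \<open>2 + (v - u) / h\<close>.\<close>
  define n where "n = nat \<lceil>(v - u) / h\<rceil>"
  have "0 \<le> (v - u) / h" using u h by simp
  then have n: "(v - u) / h \<le> n" "n \<le> (v - u) / h + 1" unfolding n_def by linarith+
  have "v \<le> (real k + 1) * h + n * h" using n(1) k2 h by (simp add: field_simps)
  then have "norm (p v - p u) \<le> (real n + 1) * \<beta>" using *[of v n] u by (simp add: algebra_simps)
  also have "\<dots> \<le> (2 + (v - u) / h) * \<beta>" using n \<open>0 \<le> \<beta>\<close> by (intro mult_right_mono) auto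
  finally show ?thesis .
qed

section \<open>Dyadic Riemann sums and their sewing limit\<close>

definition dyadic_young_sum ::
    "(real \<Rightarrow> real^'m^'d) \<Rightarrow> (real \<Rightarrow> real^'m) \<Rightarrow> nat \<Rightarrow> nat \<Rightarrow> real^'d"
  where "dyadic_young_sum f g n k = (\<Sum>j<k. f (j / 2 ^ n) *v (g (Suc j / 2 ^ n) - g (j / 2 ^ n)))"

text \<open>The left-point Riemann sum over the dyadic grid of level \<open>n\<close>, stopped at \<open>x\<close>.\<close>

definition dyadic_young ::
    "(real \<Rightarrow> real^'m^'d) \<Rightarrow> (real \<Rightarrow> real^'m) \<Rightarrow> nat \<Rightarrow> real \<Rightarrow> real^'d"
  where "dyadic_young f g n x =
    (let k = nat \<lfloor>x * 2 ^ n\<rfloor> in dyadic_young_sum f g n k + f (k / 2 ^ n) *v (g x - g (k / 2 ^ n)))"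

text \<open>The formula holds on the closed cell: at the right endpoint the floor already selects
  the next cell, but the completed last summand there equals the stopped term of the present
  cell.\<close>

lemma dyadic_young_cell:
  assumes "k / 2 ^ n \<le> x" "x \<le> Suc k / 2 ^ n"
  shows "dyadic_young f g n x = dyadic_young_sum f g n k + f (k / 2 ^ n) *v (g x - g (k / 2 ^ n))"
proof (cases "x = Suc k / 2 ^ n")
  case True
  then have "nat \<lfloor>x * 2 ^ n\<rfloor> = Suc k" by simp
  then show ?thesis using True
    by (simp add: dyadic_young_def Let_def dyadic_young_sum_def)
next
  case False
  then have "real k \<le> x * 2 ^ n" "x * 2 ^ n < k + 1" using assms by (auto simp: field_simps)
  then have "nat \<lfloor>x * 2 ^ n\<rfloor> = k" by linarith
  then show ?thesis by (simp add: dyadic_young_def Let_def)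
qed

lemma dyadic_young_diff:
  assumes "k / 2 ^ n \<le> x" "x \<le> Suc k / 2 ^ n" "k / 2 ^ n \<le> y" "y \<le> Suc k / 2 ^ n"
  shows "dyadic_young f g n y - dyadic_young f g n x = f (k / 2 ^ n) *v (g y - g x)"
  using assms by (simp add: dyadic_young_cell matrix_vector_mult_diff_distrib)

text \<open>Refining a cell changes the sum only on its right half, where the value of
  \<open>f\<close> at the left end is replaced by its value at the midpoint. The change is thus an
  increment of \<open>f\<close> applied to an increment of \<open>g\<close>, and the two Hoelder
  exponents add.\<close>

lemma dyadic_young_refine:
  fixes f :: "real \<Rightarrow> real^'m^'d"
  assumes f: "holder_bound \<alpha> 0 1 F f" and g: "holder_bound \<gamma> 0 1 G g"
    and pos: "0 \<le> \<alpha>" "0 \<le> \<gamma>"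
    and xy: "k / 2 ^ n \<le> x" "x \<le> y" "y \<le> Suc k / 2 ^ n" "y \<le> 1"
  defines "D \<equiv> \<lambda>z. dyadic_young f g (Suc n) z - dyadic_young f g n z"
  shows "norm (D y - D x) \<le> F * G * (1 / 2 ^ n) powr (\<alpha> + \<gamma>)"
proof -
  have F0: "0 \<le> F" using holder_bound_nonneg[OF f] by simp
  have G0: "0 \<le> G" using holder_bound_nonneg[OF g] by simp
  \<comment> \<open>The midpoint of the cell, written as grid point number \<open>2 * k + 1\<close>
    of the next level.\<close>
  define m :: real where "m = (2 * k + 1) / 2 ^ Suc n"
  have m: "k / 2 ^ n \<le> m" "m \<le> Suc k / 2 ^ n" "m - k / 2 ^ n \<le> 1 / 2 ^ n"
    unfolding m_def by (auto simp: field_simps)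
  have m1: "real (2 * k) / 2 ^ Suc n = k / 2 ^ n" "real (Suc (2 * k)) / 2 ^ Suc n = m"
     "real (Suc (Suc (2 * k))) / 2 ^ Suc n = Suc k / 2 ^ n"
    unfolding m_def by (auto simp: field_simps)
  have left: "D z = D w" if "k / 2 ^ n \<le> z" "z \<le> m" "k / 2 ^ n \<le> w" "w \<le> m" for z w
  proof -
    have "dyadic_young f g (Suc n) z - dyadic_young f g (Suc n) w = f (k / 2 ^ n) *v (g z - g w)"
      using dyadic_young_diff[of "2 * k" "Suc n" w z f g] that unfolding m1 by simp
    moreover have "dyadic_young f g n z - dyadic_young f g n w = f (k / 2 ^ n) *v (g z - g w)"
      using dyadic_young_diff[of k n w z f g] that m by simp
    moreover have "D z - D w = (dyadic_young f g (Suc n) z - dyadic_young f g (Suc n) w)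
        - (dyadic_young f g n z - dyadic_young f g n w)"
      unfolding D_def by simp
    ultimately show ?thesis by simp
  qed
  have right: "D z - D w = (f m - f (k / 2 ^ n)) *v (g z - g w)"
    if "m \<le> z" "z \<le> Suc k / 2 ^ n" "m \<le> w" "w \<le> Suc k / 2 ^ n" for z w
  proof -
    have "dyadic_young f g (Suc n) z - dyadic_young f g (Suc n) w = f m *v (g z - g w)"
      using dyadic_young_diff[of "Suc (2 * k)" "Suc n" w z f g] that unfolding m1 by simp
    moreover have "dyadic_young f g n z - dyadic_young f g n w = f (k / 2 ^ n) *v (g z - g w)"
      using dyadic_young_diff[of k n w z f g] that m by simp
    moreover have "D z - D w = (dyadic_young f g (Suc n) z - dyadic_young f g (Suc n) w)
        - (dyadic_young f g n z - dyadic_young f g n w)"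
      unfolding D_def by simp
    ultimately show ?thesis by (simp only: matrix_vector_mult_diff_rdistrib)
  qed
  have k0: "0 \<le> real k / 2 ^ n" by simp
  show ?thesis
  proof (cases "y \<le> m")
    case True
    then show ?thesis using left[of y x] xy F0 G0 by simp
  next
    case False
    \<comment> \<open>Only the part of \<open>[x, y]\<close> to the right of the midpoint
      contributes.\<close>
    define w where "w = max x m"
    have "Suc k / 2 ^ n = k / 2 ^ n + 1 / (2 ^ n :: real)" by (simp add: field_simps)
    then have w: "m \<le> w" "w \<le> y" "w \<le> Suc k / 2 ^ n" "0 \<le> w" "y - w \<le> 1 / 2 ^ n"
      using False xy m k0 unfolding w_def by linarith+
    have "D w = D x" using left[of m x] xy m unfolding w_def by (cases "x \<le> m") (auto simp: max_def)
    then have "D y - D x = (f m - f (k / 2 ^ n)) *v (g y - g w)"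
      using right[of y w] w xy by simp
    then have "norm (D y - D x) \<le> norm (f m - f (k / 2 ^ n)) * norm (g y - g w)"
      by (simp add: norm_matrix_vector_mult_le)
    also have "\<dots> \<le> (F * (1 / 2 ^ n) powr \<alpha>) * (G * (1 / 2 ^ n) powr \<gamma>)"
    proof (intro mult_mono)
      have "norm (f m - f (k / 2 ^ n)) \<le> F * (m - k / 2 ^ n) powr \<alpha>"
        using holder_boundD[OF f] m k0 False xy by simp
      also have "\<dots> \<le> F * (1 / 2 ^ n) powr \<alpha>"
        using F0 m k0 pos by (intro mult_left_mono powr_mono2) auto
      finally show "norm (f m - f (k / 2 ^ n)) \<le> F * (1 / 2 ^ n) powr \<alpha>" .
      have "norm (g y - g w) \<le> G * (y - w) powr \<gamma>"
        using holder_boundD[OF g] w xy by simp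
      also have "\<dots> \<le> G * (1 / 2 ^ n) powr \<gamma>"
        using G0 w pos by (intro mult_left_mono powr_mono2) auto
      finally show "norm (g y - g w) \<le> G * (1 / 2 ^ n) powr \<gamma>" .
    qed (use F0 in auto)
    finally show ?thesis by (simp add: powr_add mult_ac)
  qed
qed

text \<open>The summand 4 comes from the scale of the interval, which meets at most four dyadic cells; the other
  one is the geometric series over all finer scales.\<close>

definition young_const :: "real \<Rightarrow> real"
  where "young_const \<theta> = 4 + 3 / (1 - 2 powr (1 - \<theta>))"

lemma young_const_nonneg: "\<theta> > 1 \<Longrightarrow> 0 \<le> young_const \<theta>"
proof -
  assume "\<theta> > 1"
  then have "2 powr (1 - \<theta>) < (1::real)" using powr_less_mono[of "1-\<theta>" 0 2] by simp
  then show ?thesis unfolding young_const_def by simp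
qed

lemma diff_diff_cancel_right: "a - c - (b - c) = a - (b :: 'a::ab_group_add)"
  by simp

text \<open>About \<open>(v - u) * 2 ^ n\<close> cells of level \<open>n\<close> meet
  \<open>[u, v]\<close>, and refining each costs a multiple of \<open>2 ^ n\<close> to the power
  \<open>- (\<alpha> + \<gamma>)\<close>. Since \<alpha> + \<gamma> > 1 these costs form a geometric
  series, which is started at the level comparable to \<open>v - u\<close>.\<close>

lemma sewing_unit:
  fixes f :: "real \<Rightarrow> real^'m^'d" and g :: "real \<Rightarrow> real^'m"
  assumes f: "holder_bound \<alpha> 0 1 F f" and g: "holder_bound \<gamma> 0 1 G g"
    and pos: "0 \<le> \<alpha>" "0 \<le> \<gamma>" and \<theta>: "\<alpha> + \<gamma> > 1"
  shows "\<exists>\<Phi>. \<forall>u v. 0 \<le> u \<longrightarrow> u \<le> v \<longrightarrow> v \<le> 1 \<longrightarrow>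
    norm (\<Phi> v - \<Phi> u - f u *v (g v - g u)) \<le> young_const (\<alpha> + \<gamma>) * F * G * (v - u) powr (\<alpha> + \<gamma>)"
proof -
  define \<theta> where "\<theta> = \<alpha> + \<gamma>"
  have F0: "0 \<le> F" using holder_bound_nonneg[OF f] by simp
  have G0: "0 \<le> G" using holder_bound_nonneg[OF g] by simp
  define r :: real where "r = 2 powr (1 - \<theta>)"
  have r: "0 < r" "r < 1" using \<theta> powr_less_mono[of "1-\<theta>" 0 2] unfolding r_def \<theta>_def by auto
  have rpow: "r ^ n = (1 / 2 ^ n) powr (\<theta> - 1)" for n
  proof -
    have "r ^ n = 2 powr (real n * (1 - \<theta>))"
      unfolding r_def by (simp add: powr_realpow[symmetric] powr_powr mult.commute)
    also have "\<dots> = (2 powr (- real n)) powr (\<theta> - 1)" by (simp add: powr_powr algebra_simps)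
    also have "2 powr (- real n) = (1 / 2 ^ n :: real)" by (simp add: powr_minus powr_realpow divide_simps)
    finally show ?thesis .
  qed
  let ?P = "dyadic_young f g"
  \<comment> \<open>As the mesh is at most \<open>v - u\<close>, the count
    \<open>2 + (v - u) * 2 ^ n\<close> is at most \<open>3 * (v - u) * 2 ^ n\<close>. One factor
    \<open>2 ^ n\<close> is thereby lost, and the ratio becomes
    \<open>2 powr (1 - \<theta>)\<close>.\<close>
  have step: "norm ((?P (Suc n) v - ?P (Suc n) u) - (?P n v - ?P n u)) \<le> 3 * (v - u) * F * G * r ^ n"
    if uv: "0 \<le> u" "u \<le> v" "v \<le> 1" and n: "1 / 2 ^ n \<le> v - u" for n u v
  proof -
    have "norm ((?P (Suc n) v - ?P n v) - (?P (Suc n) u - ?P n u))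
        \<le> (2 + (v - u) / (1 / 2 ^ n)) * (F * G * (1 / 2 ^ n) powr \<theta>)"
    proof (rule norm_diff_cells_le[where p = "\<lambda>x. ?P (Suc n) x - ?P n x"])
      fix k :: nat and x y assume "k * (1 / 2 ^ n) \<le> x" "x \<le> y" "y \<le> (real k + 1) * (1 / 2 ^ n)" "u \<le> x" "y \<le> v"
      then show "norm ((?P (Suc n) y - ?P n y) - (?P (Suc n) x - ?P n x)) \<le> F * G * (1 / 2 ^ n) powr \<theta>"
        using dyadic_young_refine[OF f g pos, of k n x y] uv unfolding \<theta>_def by (simp add: add.commute)
    qed (use uv in auto)
    also have "\<dots> \<le> (3 * ((v - u) / (1 / 2 ^ n))) * (F * G * (1 / 2 ^ n) powr \<theta>)"
      using n F0 G0 by (intro mult_right_mono) (auto simp: field_simps)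
    also have "(1 / 2 ^ n :: real) powr \<theta> = r ^ n * (1 / 2 ^ n)"
      unfolding rpow using powr_add[of "1 / 2 ^ n :: real" "\<theta> - 1" 1] by simp
    finally show ?thesis by (simp add: algebra_simps)
  qed
  define \<Phi> where "\<Phi> = (\<lambda>x. lim (\<lambda>n. ?P n x))"
  have conv: "(\<lambda>n. ?P n x) \<longlonglongrightarrow> \<Phi> x" if x: "0 \<le> x" "x \<le> 1" for x
  proof (cases "x = 0")
    case True
    then have "?P n x = 0" for n by (simp add: dyadic_young_def dyadic_young_sum_def)
    then show ?thesis unfolding \<Phi>_def by simp
  next
    case False
    \<comment> \<open>All sums vanish at 0, so the increment estimate on \<open>[0, x]\<close>
      controls the values at \<open>x\<close>, from the first level whose mesh is below
      \<open>x\<close>.\<close>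
    have P0: "?P n 0 = 0" for n by (simp add: dyadic_young_def dyadic_young_sum_def)
    obtain n0 where n0: "1 / 2 ^ n0 \<le> x" using dyadic_scale[of x] x False by auto
    have "summable (\<lambda>n. ?P (Suc n) x - ?P n x)"
    proof (rule summable_comparison_test)
      show "summable (\<lambda>n. 3 * x * F * G * r ^ n)" using r by (intro summable_mult summable_geometric) auto
      show "\<exists>N. \<forall>n\<ge>N. norm (?P (Suc n) x - ?P n x) \<le> 3 * x * F * G * r ^ n"
      proof (intro exI allI impI)
        fix n assume "n0 \<le> n"
        then have "1 / 2 ^ n \<le> (1 / 2 ^ n0 :: real)" by (simp add: field_simps power_increasing)
        then show "norm (?P (Suc n) x - ?P n x) \<le> 3 * x * F * G * r ^ n"
          using step[of 0 x n] x n0 by (simp add: P0)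
      qed
    qed
    then have "convergent (\<lambda>m. \<Sum>n<m. ?P (Suc n) x - ?P n x)" by (simp add: summable_iff_convergent)
    then have "convergent (\<lambda>m. ?P m x - ?P 0 x)" by (simp add: sum_lessThan_telescope[of "\<lambda>n. ?P n x"])
    then have "convergent (\<lambda>m. ?P m x)"
      using convergent_add[OF _ convergent_const[of "?P 0 x"]] by fastforce
    then show ?thesis unfolding \<Phi>_def by (simp add: convergent_LIMSEQ_iff)
  qed
  have "norm (\<Phi> v - \<Phi> u - f u *v (g v - g u)) \<le> young_const \<theta> * F * G * (v - u) powr \<theta>"
    if uv: "0 \<le> u" "u \<le> v" "v \<le> 1" for u v
  proof (cases "u = v")
    case True then show ?thesis by simp
  next
    case False
    define d where "d = v - u"
    have d: "0 < d" "d \<le> 1" using uv False unfolding d_def by auto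
    obtain n0 where n0: "1 / 2 ^ n0 \<le> d" "d < 2 / 2 ^ n0" using dyadic_scale[OF d] by auto
    let ?e = "\<lambda>n. norm (?P n v - ?P n u - f u *v (g v - g u))"
    have base: "?e n0 \<le> 4 * F * G * d powr \<theta>"
    proof -
      define p where "p = (\<lambda>x. ?P n0 x - f u *v (g x - g u))"
      have "norm (p v - p u) \<le> (2 + (v - u) / (1 / 2 ^ n0)) * (F * G * d powr \<theta>)"
      proof (rule norm_diff_cells_le)
        fix k :: nat and x y assume kx: "k * (1 / 2 ^ n0) \<le> x" "x \<le> y" "y \<le> (real k + 1) * (1 / 2 ^ n0)" "u \<le> x" "y \<le> v"
        then have "k / 2 ^ n0 \<le> x" "y \<le> Suc k / 2 ^ n0" by (simp_all add: add.commute)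
        with kx have xy: "k / 2 ^ n0 \<le> x" "x \<le> Suc k / 2 ^ n0" "k / 2 ^ n0 \<le> y" "y \<le> Suc k / 2 ^ n0"
          by linarith+
        then have "p y - p x = (f (k / 2 ^ n0) - f u) *v (g y - g x)"
          using dyadic_young_diff[OF xy, of f g] unfolding p_def
          by (simp add: algebra_simps matrix_vector_mult_diff_rdistrib matrix_vector_mult_diff_distrib)
        then have "norm (p y - p x) \<le> norm (f (k / 2 ^ n0) - f u) * norm (g y - g x)"
          by (simp add: norm_matrix_vector_mult_le)
        also have "\<dots> \<le> (F * d powr \<alpha>) * (G * d powr \<gamma>)"
        proof (intro mult_mono)
          \<comment> \<open>The left grid point of the first cell may lie before \<open>u\<close>,
            but by no more than one mesh width, which is at most \<open>d\<close>.\<close>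
          have "x - k / 2 ^ n0 \<le> 1 / 2 ^ n0" using xy(2) by (simp add: add_divide_distrib)
          then have "\<bar>k / 2 ^ n0 - u\<bar> \<le> d" using kx uv n0(1) xy unfolding d_def by linarith
          moreover have "norm (f (k / 2 ^ n0) - f u) \<le> F * \<bar>k / 2 ^ n0 - u\<bar> powr \<alpha>"
          proof (rule holder_bound_abs[OF f])
            have "k / 2 ^ n0 \<le> (1 :: real)" using xy(1) kx uv by linarith
            then show "k / 2 ^ n0 \<in> {0..1}" unfolding atLeastAtMost_iff by (intro conjI) simp_all
          qed (use kx uv in auto)
          ultimately show "norm (f (k / 2 ^ n0) - f u) \<le> F * d powr \<alpha>"
            using F0 pos by (elim order_trans) (intro mult_left_mono powr_mono2, auto)
          have "norm (g y - g x) \<le> G * (y - x) powr \<gamma>" using holder_boundD[OF g] kx uv by auto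
          also have "\<dots> \<le> G * d powr \<gamma>"
            using G0 pos kx uv unfolding d_def by (intro mult_left_mono powr_mono2) auto
          finally show "norm (g y - g x) \<le> G * d powr \<gamma>" .
        qed (use F0 in auto)
        finally show "norm (p y - p x) \<le> F * G * d powr \<theta>" unfolding \<theta>_def by (simp add: powr_add mult_ac)
      qed (use uv in auto)
      also have "\<dots> \<le> 4 * (F * G * d powr \<theta>)"
        using n0(2) F0 G0 unfolding d_def[symmetric] by (intro mult_right_mono) (auto simp: field_simps)
      finally show ?thesis unfolding p_def by (simp add: algebra_simps matrix_vector_mult_diff_distrib)
    qed
    \<comment> \<open>The partial geometric sum is carried in closed form, which makes the induction
      step an identity in \<open>r\<close>.\<close>
    have ind: "?e n \<le> 4 * F * G * d powr \<theta> + 3 * d * F * G * ((r ^ n0 - r ^ n) / (1 - r))" if "n0 \<le> n" for n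
      using that
    proof (induction n rule: dec_induct)
      case base
      then show ?case using \<open>?e n0 \<le> _\<close> by simp
    next
      case (step n)
      have "1 / 2 ^ n \<le> (1 / 2 ^ n0 :: real)" using step by (simp add: field_simps power_increasing)
      then have "norm ((?P (Suc n) v - ?P (Suc n) u) - (?P n v - ?P n u)) \<le> 3 * d * F * G * r ^ n"
        using \<open>\<And>v u n. _ \<Longrightarrow> _ \<Longrightarrow> _ \<Longrightarrow> _ \<Longrightarrow> _ \<le> 3 * (v - u) * F * G * r ^ n\<close>[of u v n] uv n0 unfolding d_def by simp
      then have "?e (Suc n) \<le> 3 * d * F * G * r ^ n + ?e n"
        using norm_triangle_sub[of "?P (Suc n) v - ?P (Suc n) u - f u *v (g v - g u)" "?P n v - ?P n u - f u *v (g v - g u)"]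
        by (simp only: diff_diff_cancel_right)
      also have "\<dots> \<le> 3 * d * F * G * r ^ n + (4 * F * G * d powr \<theta> + 3 * d * F * G * ((r ^ n0 - r ^ n) / (1 - r)))"
        using step by simp
      also have "\<dots> = 4 * F * G * d powr \<theta> + 3 * d * F * G * (r ^ n + (r ^ n0 - r ^ n) / (1 - r))"
        by (simp add: algebra_simps)
      also have "r ^ n + (r ^ n0 - r ^ n) / (1 - r) = (r ^ n0 - r ^ Suc n) / (1 - r)"
        using r by (simp add: field_simps)
      finally show ?case .
    qed
    have bound: "?e n \<le> young_const \<theta> * F * G * d powr \<theta>" if "n0 \<le> n" for n
    proof -
      \<comment> \<open>The tail starts at \<open>r ^ n0\<close>, a power of the mesh with exponent
        \<open>\<theta> - 1\<close>; the factor \<open>d\<close> from the cell count restores the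
        exponent \<theta>.\<close>
      have "(r ^ n0 - r ^ n) / (1 - r) \<le> r ^ n0 / (1 - r)" using r by (intro divide_right_mono) auto
      also have "\<dots> \<le> d powr (\<theta> - 1) / (1 - r)"
        unfolding rpow using r n0 d \<theta> \<theta>_def by (intro divide_right_mono powr_mono2) auto
      finally have "3 * d * F * G * ((r ^ n0 - r ^ n) / (1 - r)) \<le> 3 * d * F * G * (d powr (\<theta> - 1) / (1 - r))"
        using d F0 G0 by (intro mult_left_mono) auto
      also have "\<dots> = 3 / (1 - r) * F * G * (d * d powr (\<theta> - 1))" by (simp add: field_simps)
      also have "d * d powr (\<theta> - 1) = d powr \<theta>" using d powr_add[of d "\<theta> - 1" 1] by simp
      finally show ?thesis using ind[OF that] unfolding young_const_def r_def[symmetric] by (simp add: algebra_simps)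
    qed
    have "(\<lambda>n. ?e n) \<longlonglongrightarrow> norm (\<Phi> v - \<Phi> u - f u *v (g v - g u))"
      using uv by (intro tendsto_intros conv) auto
    then show ?thesis
      by (rule LIMSEQ_le_const2) (use bound in \<open>auto simp: d_def\<close>)
  qed
  then show ?thesis unfolding \<theta>_def by blast
qed

text \<open>Affine rescaling to the unit interval, where dyadic grids live. It multiplies the
  Hoelder constants by \<open>(b - a) powr \<alpha>\<close> and
  \<open>(b - a) powr \<gamma>\<close>, which the rescaled
  \<open>(v - u) powr (\<alpha> + \<gamma>)\<close> cancels exactly, so the constant does not depend
  on the interval.\<close>

lemma sewing:
  fixes f :: "real \<Rightarrow> real^'m^'d" and g :: "real \<Rightarrow> real^'m"
  assumes ab: "a < b" and f: "holder_bound \<alpha> a b F f" and g: "holder_bound \<gamma> a b G g"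
    and pos: "0 \<le> \<alpha>" "0 \<le> \<gamma>" and \<theta>: "\<alpha> + \<gamma> > 1"
  shows "\<exists>\<Phi>. \<forall>u v. a \<le> u \<longrightarrow> u \<le> v \<longrightarrow> v \<le> b \<longrightarrow>
    norm (\<Phi> v - \<Phi> u - f u *v (g v - g u)) \<le> young_const (\<alpha> + \<gamma>) * F * G * (v - u) powr (\<alpha> + \<gamma>)"
proof -
  define s where "s = (\<lambda>x. a + (b - a) * x)"
  have s: "a \<le> s x \<and> s x \<le> s y \<and> s y \<le> b" if "0 \<le> x" "x \<le> y" "y \<le> 1" for x y
  proof -
    have "(b - a) * y \<le> b - a" using that ab by (intro mult_left_le) auto
    moreover have "(b - a) * x \<le> (b - a) * y" "0 \<le> (b - a) * x"
      using that ab by (auto intro: mult_left_mono)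
    ultimately show ?thesis unfolding s_def by simp
  qed
  have sd: "s y - s x = (b - a) * (y - x)" for x y by (simp add: s_def algebra_simps)
  have "holder_bound \<beta> 0 1 (K * (b - a) powr \<beta>) (\<lambda>x. q (s x))"
    if "holder_bound \<beta> a b K q" for \<beta> K and q :: "real \<Rightarrow> 'x::real_normed_vector"
    unfolding holder_bound_def
  proof (intro allI impI)
    fix u v :: real assume uv: "0 \<le> u" "u \<le> v" "v \<le> 1"
    have "norm (q (s v) - q (s u)) \<le> K * (s v - s u) powr \<beta>"
      using holder_boundD[OF that] s[OF uv] by blast
    also have "\<dots> = K * (b - a) powr \<beta> * (v - u) powr \<beta>" using uv ab by (simp add: sd powr_mult)
    finally show "norm (q (s v) - q (s u)) \<le> K * (b - a) powr \<beta> * (v - u) powr \<beta>" .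
  qed
  note h = this
  obtain \<Psi> where \<Psi>: "\<And>u v. 0 \<le> u \<Longrightarrow> u \<le> v \<Longrightarrow> v \<le> 1 \<Longrightarrow>
    norm (\<Psi> v - \<Psi> u - f (s u) *v (g (s v) - g (s u)))
      \<le> young_const (\<alpha> + \<gamma>) * (F * (b - a) powr \<alpha>) * (G * (b - a) powr \<gamma>) * (v - u) powr (\<alpha> + \<gamma>)"
    using sewing_unit[OF h[OF f] h[OF g] pos \<theta>] by blast
  show ?thesis
  proof (intro exI[of _ "\<lambda>t. \<Psi> ((t - a) / (b - a))"] allI impI)
    fix u v assume uv: "a \<le> u" "u \<le> v" "v \<le> b"
    let ?u = "(u - a) / (b - a)" and ?v = "(v - a) / (b - a)"
    have "0 \<le> ?u" "?u \<le> ?v" "?v \<le> 1" using uv ab by (auto intro!: divide_right_mono)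
    moreover have su: "s ?u = u" "s ?v = v" using ab by (auto simp: s_def)
    ultimately have "norm (\<Psi> ?v - \<Psi> ?u - f u *v (g v - g u)) \<le>
        young_const (\<alpha> + \<gamma>) * (F * (b - a) powr \<alpha>) * (G * (b - a) powr \<gamma>) * (?v - ?u) powr (\<alpha> + \<gamma>)"
      using \<Psi>[of ?u ?v] by (simp only: su)
    also have "\<dots> = young_const (\<alpha> + \<gamma>) * F * G * ((b - a) powr (\<alpha> + \<gamma>) * (?v - ?u) powr (\<alpha> + \<gamma>))"
      by (simp add: powr_add mult_ac)
    also have "(b - a) powr (\<alpha> + \<gamma>) * (?v - ?u) powr (\<alpha> + \<gamma>) = ((b - a) * (?v - ?u)) powr (\<alpha> + \<gamma>)"
      using ab \<open>?u \<le> ?v\<close> by (simp add: powr_mult)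
    also have "(b - a) * (?v - ?u) = v - u"
      using ab by (subst diff_divide_distrib[symmetric]) simp
    finally show "norm (\<Psi> ?v - \<Psi> ?u - f u *v (g v - g u)) \<le> young_const (\<alpha> + \<gamma>) * F * G * (v - u) powr (\<alpha> + \<gamma>)" .
  qed
qed

section \<open>Convergence of the Riemann-Stieltjes sums\<close>

lemma has_young_integral_unique:
  assumes "has_young_integral f g I a b" "has_young_integral f g J a b"
  shows "I = J"
proof (rule ccontr)
  assume "I \<noteq> J"
  define e where "e = norm (I - J) / 2"
  have "e > 0" using \<open>I \<noteq> J\<close> by (simp add: e_def)
  obtain d1 where d1: "d1 > 0" "\<forall>D. D tagged_division_of {a..b} \<and> (\<forall>(\<xi>, K)\<in>D. Sup K - Inf K < d1)
      \<longrightarrow> norm (stieltjes_sum f g D - I) < e"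
    using assms(1)[unfolded has_young_integral_def, rule_format, OF \<open>e > 0\<close>] by (elim exE conjE)
  obtain d2 where d2: "d2 > 0" "\<forall>D. D tagged_division_of {a..b} \<and> (\<forall>(\<xi>, K)\<in>D. Sup K - Inf K < d2)
      \<longrightarrow> norm (stieltjes_sum f g D - J) < e"
    using assms(2)[unfolded has_young_integral_def, rule_format, OF \<open>e > 0\<close>] by (elim exE conjE)
  define d where "d = min d1 d2"
  \<comment> \<open>Cousin's lemma supplies a tagged division of mesh below \<open>d\<close>, so the
    limit condition is not vacuous. Radius \<open>d / 2\<close> works because both endpoints of an
    interval lie in the ball around its tag.\<close>
  have "gauge (\<lambda>x::real. ball x (d / 2))" using d1 d2 by (intro gauge_ball) (auto simp: d_def)
  then obtain D where D: "D tagged_division_of {a..b}" "(\<lambda>x. ball x (d / 2)) fine D"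
    using fine_division_exists_real by blast
  have "Sup K - Inf K < d" if xK: "(\<xi>, K) \<in> D" for \<xi> K
  proof -
    obtain c e where K: "K = cbox c e" using tagged_division_ofD(4)[OF D(1) xK] by blast
    moreover have "\<xi> \<in> K" using tagged_division_ofD(2)[OF D(1) xK] .
    ultimately have K: "K = {c..e}" "c \<le> e" by auto
    have "K \<subseteq> ball \<xi> (d / 2)" using D(2) xK by (auto simp: fine_def)
    then have "c \<in> ball \<xi> (d / 2)" "e \<in> ball \<xi> (d / 2)" using K by auto
    then have "\<bar>\<xi> - c\<bar> < d / 2" "\<bar>\<xi> - e\<bar> < d / 2" by (auto simp: dist_real_def)
    then have "e - c < d" by linarith
    then show ?thesis using K by simp
  qed
  then have "\<forall>(\<xi>, K)\<in>D. Sup K - Inf K < d1" "\<forall>(\<xi>, K)\<in>D. Sup K - Inf K < d2"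
    unfolding d_def by (auto simp: min_less_iff_conj)
  then have "norm (stieltjes_sum f g D - I) < e" "norm (stieltjes_sum f g D - J) < e"
    using d1 d2 D by blast+
  then have "norm (I - J) < 2 * e"
    using norm_triangle_ineq4[of "stieltjes_sum f g D - J" "stieltjes_sum f g D - I"] by simp
  then show False by (simp add: e_def)
qed

lemma young_integral_eqI: "has_young_integral f g J a b \<Longrightarrow> young_integral a b f g = J"
  unfolding young_integral_def using has_young_integral_unique by blast

text \<open>Comparing each Riemann sum with the increments of the additive function \<open>\<Phi>\<close>, interval by interval,
  avoids common refinements of tagged divisions.\<close>

lemma has_young_integral_sewing:
  fixes f :: "real \<Rightarrow> real^'m^'d" and g :: "real \<Rightarrow> real^'m"
  assumes ab: "a \<le> b" and f: "holder_bound \<alpha> a b F f" and g: "holder_bound \<gamma> a b G g"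
    and nonneg: "0 \<le> F" "0 \<le> G"
    and pos: "0 \<le> \<alpha>" "0 \<le> \<gamma>" and \<theta>: "\<alpha> + \<gamma> > 1"
    and \<Phi>: "\<And>u v. a \<le> u \<Longrightarrow> u \<le> v \<Longrightarrow> v \<le> b \<Longrightarrow>
      norm (\<Phi> v - \<Phi> u - f u *v (g v - g u)) \<le> C * (v - u) powr (\<alpha> + \<gamma>)"
  shows "has_young_integral f g (\<Phi> b - \<Phi> a) a b"
  unfolding has_young_integral_def
proof (intro allI impI)
  fix \<epsilon> :: real assume "\<epsilon> > 0"
  \<comment> \<open>The summand 1 makes \<open>A\<close> positive and the last inequality strict,
    through the factor \<open>(A - 1) / A\<close>. The absolute value is there because no sign is
    assumed for \<open>C\<close>.\<close>
  define A where "A = (F * G + \<bar>C\<bar>) * (b - a) + 1"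
  have A: "A > 0" using ab nonneg unfolding A_def by (smt (verit) mult_nonneg_nonneg)
  \<comment> \<open>Each interval contributes its length times at most
    \<open>\<delta> powr (\<alpha> + \<gamma> - 1)\<close>, up to the constant; this \<delta> makes
    that power equal to \<open>\<epsilon> / A\<close>, and the lengths add up to
    \<open>b - a\<close>.\<close>
  define \<delta> where "\<delta> = (\<epsilon> / A) powr (1 / (\<alpha> + \<gamma> - 1))"
  have \<delta>: "\<delta> > 0" "\<delta> powr (\<alpha> + \<gamma> - 1) = \<epsilon> / A"
    using A \<open>\<epsilon> > 0\<close> \<theta> unfolding \<delta>_def by (auto simp: powr_powr)
  show "\<exists>\<delta>>0. \<forall>D. D tagged_division_of {a..b} \<and> (\<forall>(\<xi>, K)\<in>D. Sup K - Inf K < \<delta>) \<longrightarrow>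
       norm (stieltjes_sum f g D - (\<Phi> b - \<Phi> a)) < \<epsilon>"
  proof (intro exI conjI allI impI)
    fix D assume "D tagged_division_of {a..b} \<and> (\<forall>(\<xi>, K)\<in>D. Sup K - Inf K < \<delta>)"
    then have D: "D tagged_division_of {a..b}" and fine: "\<And>\<xi> K. (\<xi>, K) \<in> D \<Longrightarrow> Sup K - Inf K < \<delta>" by auto
    have "stieltjes_sum f g D - (\<Phi> b - \<Phi> a) =
        (\<Sum>(\<xi>, K)\<in>D. f \<xi> *v (g (Sup K) - g (Inf K)) - (\<Phi> (Sup K) - \<Phi> (Inf K)))"
      unfolding stieltjes_sum_def additive_tagged_division_1[OF ab D, of \<Phi>, symmetric]
      by (simp add: sum_subtractf[symmetric] case_prod_beta)
    also have "norm \<dots> \<le> (\<Sum>(\<xi>, K)\<in>D. (F * G + \<bar>C\<bar>) * (\<epsilon> / A) * (Sup K - Inf K))"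
      unfolding case_prod_beta
    proof (rule sum_norm_le)
      fix z assume z: "z \<in> D"
      obtain \<xi> K where zK: "z = (\<xi>, K)" by (cases z)
      obtain c e where K: "K = cbox c e" using tagged_division_ofD(4)[OF D] z zK by blast
      have \<xi>: "\<xi> \<in> K" using tagged_division_ofD(2)[OF D] z zK by blast
      have "K \<subseteq> {a..b}" using tagged_division_ofD(3)[OF D] z zK by blast
      with K \<xi> have ce: "K = {c..e}" "a \<le> c" "c \<le> \<xi>" "\<xi> \<le> e" "e \<le> b" by auto
      then have SI: "Sup K = e" "Inf K = c" by auto
      have lt: "e - c < \<delta>" using fine[of \<xi> K] z zK SI by simp
      \<comment> \<open>The tag is arbitrary in its interval; moving it to the left endpoint costs
        one more product of increments, of the same order as the sewing error.\<close>
      have "f \<xi> *v (g e - g c) - (\<Phi> e - \<Phi> c) =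
          (f \<xi> - f c) *v (g e - g c) - (\<Phi> e - \<Phi> c - f c *v (g e - g c))"
        by (simp add: matrix_vector_mult_diff_rdistrib)
      also have "norm \<dots> \<le> norm (f \<xi> - f c) * norm (g e - g c) + C * (e - c) powr (\<alpha> + \<gamma>)"
        using norm_triangle_ineq4 norm_matrix_vector_mult_le \<Phi>[of c e] ce
        by (smt (verit, ccfv_threshold))
      also have "\<dots> \<le> (F * (e - c) powr \<alpha>) * (G * (e - c) powr \<gamma>) + \<bar>C\<bar> * (e - c) powr (\<alpha> + \<gamma>)"
      proof (intro add_mono mult_mono)
        have "norm (f \<xi> - f c) \<le> F * (\<xi> - c) powr \<alpha>" using holder_boundD[OF f, of c \<xi>] ce by simp
        also have "\<dots> \<le> F * (e - c) powr \<alpha>" using ce nonneg pos by (intro mult_left_mono powr_mono2) auto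
        finally show "norm (f \<xi> - f c) \<le> F * (e - c) powr \<alpha>" .
        show "norm (g e - g c) \<le> G * (e - c) powr \<gamma>" using holder_boundD[OF g, of c e] ce by simp
      qed (use nonneg in auto)
      also have "\<dots> = (F * G + \<bar>C\<bar>) * (e - c) powr (\<alpha> + \<gamma>)" by (simp add: powr_add algebra_simps)
      also have "(e - c) powr (\<alpha> + \<gamma>) = (e - c) powr (\<alpha> + \<gamma> - 1) * (e - c)"
        using powr_add[of "e - c" "\<alpha> + \<gamma> - 1" 1] ce by simp
      also have "(F * G + \<bar>C\<bar>) * \<dots> \<le> (F * G + \<bar>C\<bar>) * (\<delta> powr (\<alpha> + \<gamma> - 1) * (e - c))"
        using nonneg ce lt \<theta> by (intro mult_left_mono mult_right_mono powr_mono2) auto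
      finally show "norm (f (fst z) *v (g (Sup (snd z)) - g (Inf (snd z))) - (\<Phi> (Sup (snd z)) - \<Phi> (Inf (snd z))))
        \<le> (F * G + \<bar>C\<bar>) * (\<epsilon> / A) * (Sup (snd z) - Inf (snd z))"
        using SI zK \<delta>(2) by (simp add: mult.assoc)
    qed
    also have "\<dots> = (F * G + \<bar>C\<bar>) * (\<epsilon> / A) * (b - a)"
      unfolding additive_tagged_division_1[OF ab D, of "\<lambda>x. x", symmetric]
      by (simp add: sum_distrib_left case_prod_beta)
    also have "\<dots> = \<epsilon> * ((A - 1) / A)" unfolding A_def by (simp add: field_simps)
    also have "\<dots> < \<epsilon>" using A \<open>\<epsilon> > 0\<close> by (simp add: field_simps)
    finally show "norm (stieltjes_sum f g D - (\<Phi> b - \<Phi> a)) < \<epsilon>" .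
  qed (fact \<delta>)
qed

text \<open>The remainder involves the constant \<open>F'\<close> of \<open>f\<close> on
  \<open>[u, v]\<close>, while \<open>F\<close> guarantees that the integrals from \<open>a\<close>
  exist. \<Phi> is sewn on \<open>[a, b]\<close> and \<Psi> on \<open>[u, v]\<close>; their
  increments over \<open>[u, v]\<close> are limits of the same sums and hence agree.\<close>

lemma young_integral_increment:
  fixes f :: "real \<Rightarrow> real^'m^'d" and g :: "real \<Rightarrow> real^'m"
  assumes T: "a < b" and f: "holder_bound \<alpha> a b F f" and g: "holder_bound \<gamma> a b G g"
    and pos: "0 \<le> \<alpha>" "0 \<le> \<gamma>" and \<theta>: "\<alpha> + \<gamma> > 1"
    and uv: "a \<le> u" "u < v" "v \<le> b" and floc: "holder_bound \<alpha> u v F' f"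
  shows "norm (young_integral a v f g - young_integral a u f g - f u *v (g v - g u))
    \<le> young_const (\<alpha> + \<gamma>) * F' * G * (v - u) powr (\<alpha> + \<gamma>)"
proof -
  have F0: "0 \<le> F" "0 \<le> F'" using holder_bound_nonneg f floc uv T by blast+
  have G0: "0 \<le> G" using holder_bound_nonneg g T by blast
  obtain \<Phi> where \<Phi>: "\<And>u v. a \<le> u \<Longrightarrow> u \<le> v \<Longrightarrow> v \<le> b \<Longrightarrow>
    norm (\<Phi> v - \<Phi> u - f u *v (g v - g u)) \<le> young_const (\<alpha> + \<gamma>) * F * G * (v - u) powr (\<alpha> + \<gamma>)"
    using sewing[OF T f g pos \<theta>] by blast
  have *: "has_young_integral f g (\<Phi> t - \<Phi> s) s t" if "a \<le> s" "s \<le> t" "t \<le> b" for s t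
    using that F0 G0 \<Phi>
    by (intro has_young_integral_sewing[OF _ holder_bound_subset[OF f] holder_bound_subset[OF g] _ _ pos \<theta>,
        where C = "young_const (\<alpha> + \<gamma>) * F * G"]) auto
  have gloc: "holder_bound \<gamma> u v G g" using holder_bound_subset[OF g] uv by blast
  obtain \<Psi> where \<Psi>: "\<And>s t. u \<le> s \<Longrightarrow> s \<le> t \<Longrightarrow> t \<le> v \<Longrightarrow>
    norm (\<Psi> t - \<Psi> s - f s *v (g t - g s)) \<le> young_const (\<alpha> + \<gamma>) * F' * G * (t - s) powr (\<alpha> + \<gamma>)"
    using sewing[OF uv(2) floc gloc pos \<theta>] by blast
  have "has_young_integral f g (\<Psi> v - \<Psi> u) u v"
    using has_young_integral_sewing[OF _ floc gloc F0(2) G0 pos \<theta> \<Psi>] uv by simp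
  then have "\<Psi> v - \<Psi> u = \<Phi> v - \<Phi> u" using has_young_integral_unique *[of u v] uv by auto
  moreover have "young_integral a v f g = \<Phi> v - \<Phi> a" "young_integral a u f g = \<Phi> u - \<Phi> a"
    using uv by (auto intro!: young_integral_eqI *)
  ultimately show ?thesis using \<Psi>[of u v] uv by simp
qed

section \<open>Kolmogorov's moment criterion\<close>

text \<open>Chaining along dyadic approximations from the left. At the level comparable to
  \<open>v - u\<close> the approximations of \<open>u\<close> and \<open>v\<close> are at most two
  cells apart, which gives the summand 2; the two geometric tails from \<open>u\<close> and
  \<open>v\<close> give the other summand.\<close>

lemma holder_bound_of_dyadic_unit:
  fixes f :: "real \<Rightarrow> 'b::real_normed_vector"
  assumes \<gamma>: "\<gamma> > 0" and cont: "continuous_on {0..1} f"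
    and step: "\<And>n k. k < 2 ^ n \<Longrightarrow> norm (f (Suc k / 2 ^ n) - f (k / 2 ^ n)) \<le> A * (1 / 2 ^ n) powr \<gamma>"
  shows "holder_bound \<gamma> 0 1 ((2 + 2 / (1 - 2 powr - \<gamma>)) * A) f"
  unfolding holder_bound_def
proof (intro allI impI)
  define r :: real where "r = 2 powr - \<gamma>"
  have r: "0 < r" "r < 1" using powr_less_mono[of "-\<gamma>" 0 2] \<gamma> unfolding r_def by auto
  have rpow: "(1 / 2 ^ n) powr \<gamma> = r ^ n" for n
  proof -
    have "r ^ n = 2 powr (real n * - \<gamma>)"
      unfolding r_def by (simp add: powr_realpow[symmetric] powr_powr mult.commute)
    also have "\<dots> = (2 powr (- real n)) powr \<gamma>" by (simp add: powr_powr)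
    also have "2 powr (- real n) = (1 / 2 ^ n :: real)" by (simp add: powr_minus powr_realpow divide_simps)
    finally show ?thesis by simp
  qed
  have A: "0 \<le> A"
    using order_trans[OF norm_ge_zero step[of 0 0]] by simp
  define k where "k = (\<lambda>n (x::real). nat \<lfloor>x * 2 ^ n\<rfloor> :: nat)"
  have k: "real (k n x) \<le> x * 2 ^ n" "x * 2 ^ n < real (k n x) + 1" if "0 \<le> x" for n and x :: real
  proof -
    have "0 \<le> x * 2 ^ n" using that by simp
    then show "real (k n x) \<le> x * 2 ^ n" "x * 2 ^ n < real (k n x) + 1" unfolding k_def by linarith+
  qed
  define \<pi> where "\<pi> = (\<lambda>n x. real (k n x) / 2 ^ n)"
  have \<pi>: "0 \<le> \<pi> n x" "\<pi> n x \<le> x" "x - \<pi> n x \<le> 1 / 2 ^ n" if "0 \<le> x" for n x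
  proof -
    have "x \<le> (real (k n x) + 1) / 2 ^ n" "real (k n x) / 2 ^ n \<le> x"
      using k[OF that, of n] by (simp_all add: pos_le_divide_eq pos_divide_le_eq)
    then show "0 \<le> \<pi> n x" "\<pi> n x \<le> x" "x - \<pi> n x \<le> 1 / 2 ^ n"
      unfolding \<pi>_def by (auto simp: add_divide_distrib)
  qed
  have approx: "norm (f x - f (\<pi> n x)) \<le> A * r ^ n / (1 - r)" if x: "0 \<le> x" "x \<le> 1" for x n
  proof -
    have ref: "norm (f (\<pi> (Suc m) x) - f (\<pi> m x)) \<le> A * r ^ m" for m
    proof -
      \<comment> \<open>Passing to the next level keeps the approximating point or moves it right by
        one cell of that level, so a single dyadic increment is paid.\<close>
      have "real (2 * k m x) \<le> x * 2 ^ Suc m" "x * 2 ^ Suc m < real (2 * k m x + 2)" using k[OF x(1), of m] by auto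
      moreover have "x * 2 ^ Suc m \<ge> 0" using x by simp
      ultimately have "k (Suc m) x = 2 * k m x \<or> k (Suc m) x = Suc (2 * k m x)"
        unfolding k_def[of, THEN fun_cong, THEN fun_cong, of "Suc m" x] by linarith
      then show ?thesis
      proof
        assume "k (Suc m) x = 2 * k m x"
        then have "\<pi> (Suc m) x = \<pi> m x" unfolding \<pi>_def by simp
        then show ?thesis using A r by simp
      next
        assume *: "k (Suc m) x = Suc (2 * k m x)"
        have "real (k (Suc m) x) \<le> x * 2 ^ Suc m" using k[OF x(1)] by blast
        also have "\<dots> \<le> 2 ^ Suc m" using x by (simp add: mult_left_le_one_le)
        finally have "real (Suc (2 * k m x)) \<le> real (2 ^ Suc m)" using * by simp
        then have "2 * k m x < 2 ^ Suc m" by (simp only: of_nat_le_iff Suc_le_eq)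
        then have "norm (f (Suc (2 * k m x) / 2 ^ Suc m) - f ((2 * k m x) / 2 ^ Suc m)) \<le> A * r ^ Suc m"
          using step[of "2 * k m x" "Suc m"] unfolding rpow by simp
        also have "\<dots> \<le> A * r ^ m" using A r by (intro mult_left_mono power_decreasing) auto
        finally show ?thesis using * unfolding \<pi>_def by simp
      qed
    qed
    have ind: "norm (f (\<pi> m x) - f (\<pi> n x)) \<le> A * (r ^ n - r ^ m) / (1 - r)" if "n \<le> m" for m
      using that
    proof (induction m rule: dec_induct)
      case (step m)
      have "norm (f (\<pi> (Suc m) x) - f (\<pi> n x)) \<le> A * r ^ m + A * (r ^ n - r ^ m) / (1 - r)"
        using norm_triangle_ineq[of "f (\<pi> (Suc m) x) - f (\<pi> m x)" "f (\<pi> m x) - f (\<pi> n x)"] ref[of m] step.IH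
        by simp
      also have "\<dots> = A * (r ^ n - r ^ Suc m) / (1 - r)" using r by (simp add: field_simps)
      finally show ?case .
    qed simp
    \<comment> \<open>Continuity carries the estimate from dyadic points to arbitrary
      \<open>x\<close>.\<close>
    have "(\<lambda>m. \<pi> m x) \<longlonglongrightarrow> x"
    proof (rule tendsto_sandwich)
      show "(\<lambda>m. x - 1 / 2 ^ m) \<longlonglongrightarrow> x"
        using tendsto_diff[OF tendsto_const LIMSEQ_power_zero[of "1/2::real"], of x] by (simp add: power_divide)
      show "\<forall>\<^sub>F m in sequentially. x - 1 / 2 ^ m \<le> \<pi> m x" using \<pi>[OF x(1)] by (auto simp: algebra_simps)
      show "\<forall>\<^sub>F m in sequentially. \<pi> m x \<le> x" using \<pi>[OF x(1)] by auto
    qed simp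
    then have "(\<lambda>m. f (\<pi> m x)) \<longlonglongrightarrow> f x"
      using \<pi>[OF x(1)] x
      by (intro continuous_on_tendsto_compose[OF cont]) (auto intro!: always_eventually order_trans[of _ x 1])
    then have "(\<lambda>m. norm (f (\<pi> m x) - f (\<pi> n x))) \<longlonglongrightarrow> norm (f x - f (\<pi> n x))"
      by (intro tendsto_intros)
    then show ?thesis
    proof (rule LIMSEQ_le_const2, intro exI[of _ n] allI impI)
      fix m assume "n \<le> m"
      have "A * (r ^ n - r ^ m) / (1 - r) \<le> A * r ^ n / (1 - r)"
        using A r by (intro divide_right_mono mult_left_mono) auto
      with ind[OF \<open>n \<le> m\<close>] show "norm (f (\<pi> m x) - f (\<pi> n x)) \<le> A * r ^ n / (1 - r)" by linarith
    qed
  qed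
  fix u v :: real assume uv: "0 \<le> u" "u \<le> v" "v \<le> 1"
  show "norm (f v - f u) \<le> (2 + 2 / (1 - 2 powr - \<gamma>)) * A * (v - u) powr \<gamma>"
  proof (cases "u = v")
    case False
    then obtain n where n: "1 / 2 ^ n \<le> v - u" "v - u < 2 / 2 ^ n"
      using dyadic_scale[of "v - u"] uv by auto
    have v0: "0 \<le> v" using uv by simp
    have "v * 2 ^ n \<le> 2 ^ n" using uv by (simp add: mult_left_le_one_le)
    then have "real (k n v) \<le> real (2 ^ n)"
      using order_trans[OF k(1)[OF v0, of n]] unfolding of_nat_power of_nat_numeral by blast
    then have kv: "k n v \<le> 2 ^ n" by (simp only: of_nat_le_iff)
    \<comment> \<open>A distance below two mesh widths plus a rounding error below one puts the
      indices less than 3 apart.\<close>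
    have "(v - u) * 2 ^ n < 2" using n(2) by (simp add: field_simps)
    then have "real (k n v) < real (k n u) + 3" using k[OF v0, of n] k[OF uv(1), of n] by (simp add: algebra_simps)
    moreover have "k n u \<le> k n v" unfolding k_def using uv by (intro nat_mono floor_mono) (auto intro: mult_right_mono)
    ultimately have "k n v = k n u \<or> k n v = Suc (k n u) \<or> k n v = Suc (Suc (k n u))" by linarith
    then have mid: "norm (f (\<pi> n v) - f (\<pi> n u)) \<le> 2 * A * r ^ n"
    proof (elim disjE)
      assume "k n v = k n u" then show ?thesis using A r by (simp add: \<pi>_def)
    next
      assume *: "k n v = Suc (k n u)"
      then have "norm (f (\<pi> n v) - f (\<pi> n u)) \<le> A * r ^ n"
        using step[of "k n u" n] kv unfolding \<pi>_def rpow by simp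
      moreover have "0 \<le> A * r ^ n" using A r by simp
      ultimately show ?thesis by simp
    next
      assume *: "k n v = Suc (Suc (k n u))"
      then have "norm (f (\<pi> n v) - f (Suc (k n u) / 2 ^ n)) \<le> A * r ^ n"
        "norm (f (Suc (k n u) / 2 ^ n) - f (\<pi> n u)) \<le> A * r ^ n"
        using step[of "k n u" n] step[of "Suc (k n u)" n] kv unfolding \<pi>_def rpow by simp_all
      then show ?thesis
        using norm_triangle_ineq[of "f (\<pi> n v) - f (Suc (k n u) / 2 ^ n)" "f (Suc (k n u) / 2 ^ n) - f (\<pi> n u)"]
        by simp
    qed
    have "norm (f v - f u) \<le> norm ((f v - f (\<pi> n v)) + (f (\<pi> n v) - f (\<pi> n u))) + norm (f u - f (\<pi> n u))"
      using norm_triangle_ineq4[of "(f v - f (\<pi> n v)) + (f (\<pi> n v) - f (\<pi> n u))" "f u - f (\<pi> n u)"] by simp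
    also have "\<dots> \<le> norm (f v - f (\<pi> n v)) + norm (f (\<pi> n v) - f (\<pi> n u)) + norm (f u - f (\<pi> n u))"
      by (intro add_right_mono norm_triangle_ineq)
    also have "\<dots> \<le> A * r ^ n / (1 - r) + 2 * A * r ^ n + A * r ^ n / (1 - r)"
      using approx[of v n] approx[of u n] mid uv by (intro add_mono) auto
    also have "\<dots> = (2 + 2 / (1 - r)) * A * (1 / 2 ^ n) powr \<gamma>"
      unfolding rpow by (simp add: algebra_simps)
    also have "\<dots> \<le> (2 + 2 / (1 - r)) * A * (v - u) powr \<gamma>"
      using n A r \<gamma> by (intro mult_left_mono powr_mono2) auto
    finally show ?thesis unfolding r_def .
  qed simp
qed

lemma holder_bound_of_dyadic:
  fixes f :: "real \<Rightarrow> 'b::real_normed_vector"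
  assumes T: "T > 0" and \<gamma>: "\<gamma> > 0" and cont: "continuous_on {0..T} f"
    and step: "\<And>n k. k < 2 ^ n \<Longrightarrow>
      norm (f (T * (Suc k / 2 ^ n)) - f (T * (k / 2 ^ n))) \<le> A * (1 / 2 ^ n) powr \<gamma>"
  shows "holder_bound \<gamma> 0 T ((2 + 2 / (1 - 2 powr - \<gamma>)) * A / T powr \<gamma>) f"
  unfolding holder_bound_def
proof (intro allI impI)
  fix u v assume uv: "0 \<le> u" "u \<le> v" "v \<le> T"
  have "continuous_on {0..1} (\<lambda>x. f (T * x))"
    using T by (intro continuous_on_compose2[OF cont] continuous_intros) (auto simp: mult_left_le)
  then have "holder_bound \<gamma> 0 1 ((2 + 2 / (1 - 2 powr - \<gamma>)) * A) (\<lambda>x. f (T * x))"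
    using holder_bound_of_dyadic_unit[OF \<gamma> _ step] by blast
  then have "norm (f (T * (v / T)) - f (T * (u / T))) \<le> (2 + 2 / (1 - 2 powr - \<gamma>)) * A * (v / T - u / T) powr \<gamma>"
    using uv T by (intro holder_boundD) (auto intro: divide_right_mono)
  also have "(v / T - u / T) powr \<gamma> = (v - u) powr \<gamma> / T powr \<gamma>"
    using uv T by (simp add: diff_divide_distrib[symmetric] powr_divide)
  finally show "norm (f v - f u) \<le> (2 + 2 / (1 - 2 powr - \<gamma>)) * A / T powr \<gamma> * (v - u) powr \<gamma>"
    using T by simp
qed

text \<open>\<open>S\<close> sums the weighted \<open>q\<close>-th powers of all dyadic increments.
  Each increment is dominated by the sum, which yields the Hoelder bound, while the expectation is
  computed term by term. A sum in place of a supremum gives measurability and the moment at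
  once.\<close>

lemma kolmogorov_holder_moment:
  fixes B :: "real \<Rightarrow> 'a \<Rightarrow> 'b::{second_countable_topology, real_normed_vector}" and q :: nat
    and T \<gamma> r K :: real
  assumes T: "T > 0" and \<gamma>: "\<gamma> > 0" and q: "q > 0" and r: "r > 1 + \<gamma> * q" and K: "K \<ge> 0"
    and meas [measurable]: "\<And>t. t \<in> {0..T} \<Longrightarrow> B t \<in> borel_measurable M"
    and cont: "\<And>\<omega>. \<omega> \<in> space M \<Longrightarrow> continuous_on {0..T} (\<lambda>t. B t \<omega>)"
    and moment: "\<And>s t. s \<in> {0..T} \<Longrightarrow> t \<in> {0..T} \<Longrightarrow>
      (\<integral>\<^sup>+\<omega>. ennreal (norm (B t \<omega> - B s \<omega>) ^ q) \<partial>M) \<le> ennreal (K * \<bar>t - s\<bar> powr r)"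
  shows "\<exists>G. G \<in> borel_measurable M \<and> (\<forall>\<omega>. 0 \<le> G \<omega>) \<and> integrable M (\<lambda>\<omega>. G \<omega> ^ q) \<and>
    (AE \<omega> in M. holder_bound \<gamma> 0 T (G \<omega>) (\<lambda>t. B t \<omega>))"
proof -
  define d where "d = (\<lambda>n k \<omega>. norm (B (T * (Suc k / 2 ^ n)) \<omega> - B (T * (k / 2 ^ n)) \<omega>))"
  have grid: "T * (k / 2 ^ n) \<in> {0..T}" if "k \<le> 2 ^ n" for k n :: nat
  proof -
    have "real k \<le> 2 ^ n" using that by (metis of_nat_le_iff of_nat_numeral of_nat_power)
    then have "real k / 2 ^ n \<le> 1" by simp
    then show ?thesis using T by (auto simp: mult_left_le simp del: divide_le_eq_1_pos times_divide_eq_right)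
  qed
  have d: "d n k \<in> borel_measurable M" if "k < 2 ^ n" for n k
  proof -
    have [measurable]: "B (T * (Suc k / 2 ^ n)) \<in> borel_measurable M" "B (T * (k / 2 ^ n)) \<in> borel_measurable M"
      using that by (intro meas grid; simp)+
    show ?thesis unfolding d_def by measurable
  qed
  \<comment> \<open>The weight offsets \<open>(1 / 2 ^ n) powr (\<gamma> * q)\<close>, so that a
    bound on \<open>S\<close> is a bound on all \<gamma>-Hoelder quotients over dyadic
    cells.\<close>
  define w where "w = (\<lambda>n::nat. 2 powr (n * \<gamma> * q))"
  define S where "S = (\<lambda>\<omega>. \<Sum>n. \<Sum>k<2 ^ n. ennreal (w n * d n k \<omega> ^ q))"
  have term_meas: "(\<lambda>\<omega>. ennreal (w n * d n k \<omega> ^ q)) \<in> borel_measurable M" if "k < 2 ^ n" for n k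
    using d[OF that] by measurable
  have level_meas [measurable]: "(\<lambda>\<omega>. \<Sum>k<2 ^ n. ennreal (w n * d n k \<omega> ^ q)) \<in> borel_measurable M" for n
    by (intro borel_measurable_sum term_meas) auto
  have S_meas [measurable]: "S \<in> borel_measurable M"
    unfolding S_def by measurable
  \<comment> \<open>Level \<open>n\<close> has \<open>2 ^ n\<close> cells of weight
    \<open>2 powr (n * \<gamma> * q)\<close>, each with moment of order
    \<open>2 powr (- n * r)\<close>; \<rho> is the resulting ratio, below 1 exactly because
    \<open>r > 1 + \<gamma> * q\<close>.\<close>
  define \<rho> where "\<rho> = 2 powr (1 + \<gamma> * q - r)"
  have \<rho>: "0 < \<rho>" "\<rho> < 1" using r powr_less_mono[of "1 + \<gamma> * q - r" 0 2] unfolding \<rho>_def by auto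
  have level: "(\<integral>\<^sup>+\<omega>. (\<Sum>k<2 ^ n. ennreal (w n * d n k \<omega> ^ q)) \<partial>M) \<le> ennreal (K * T powr r * \<rho> ^ n)" for n
  proof -
    have "(\<integral>\<^sup>+\<omega>. (\<Sum>k<2 ^ n. ennreal (w n * d n k \<omega> ^ q)) \<partial>M) = (\<Sum>k<2 ^ n. \<integral>\<^sup>+\<omega>. ennreal (w n * d n k \<omega> ^ q) \<partial>M)"
      by (intro nn_integral_sum term_meas) auto
    also have "\<dots> \<le> (\<Sum>k<(2::nat) ^ n. ennreal (w n * (K * (T / 2 ^ n) powr r)))"
    proof (rule sum_mono)
      fix k :: nat assume "k \<in> {..<2 ^ n}"
      then have k: "k < 2 ^ n" by simp
      have "(\<integral>\<^sup>+\<omega>. ennreal (w n * d n k \<omega> ^ q) \<partial>M) = (\<integral>\<^sup>+\<omega>. ennreal (w n) * ennreal (d n k \<omega> ^ q) \<partial>M)"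
        by (intro nn_integral_cong) (simp add: ennreal_mult w_def d_def)
      also have "\<dots> = ennreal (w n) * (\<integral>\<^sup>+\<omega>. ennreal (d n k \<omega> ^ q) \<partial>M)"
        by (intro nn_integral_cmult measurable_compose[OF _ measurable_ennreal] borel_measurable_power d k)
      also have "\<dots> \<le> ennreal (w n) * ennreal (K * \<bar>T * (Suc k / 2 ^ n) - T * (k / 2 ^ n)\<bar> powr r)"
        unfolding d_def using k by (intro mult_left_mono moment grid) auto
      also have "T * (Suc k / 2 ^ n) - T * (k / 2 ^ n) = T / 2 ^ n" by (simp add: field_simps)
      finally show "(\<integral>\<^sup>+\<omega>. ennreal (w n * d n k \<omega> ^ q) \<partial>M) \<le> ennreal (w n * (K * (T / 2 ^ n) powr r))"
        using T K by (simp add: ennreal_mult w_def)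
    qed
    also have "\<dots> = ennreal (2 ^ n * (w n * (K * (T / 2 ^ n) powr r)))"
      by (simp add: ennreal_mult'' ennreal_power[symmetric] w_def K)
    also have "2 ^ n * (w n * (K * (T / 2 ^ n) powr r)) = K * T powr r * (2 powr n * 2 powr (n * \<gamma> * q) / (2 powr n) powr r)"
      using T unfolding w_def by (simp add: powr_divide powr_realpow)
    also have "2 powr n * 2 powr (n * \<gamma> * q) / (2 powr n) powr r = \<rho> ^ n"
      unfolding \<rho>_def by (simp add: powr_powr powr_add[symmetric] powr_diff[symmetric] powr_realpow[symmetric] algebra_simps)
    finally show ?thesis .
  qed
  have "(\<integral>\<^sup>+\<omega>. S \<omega> \<partial>M) = (\<Sum>n. \<integral>\<^sup>+\<omega>. (\<Sum>k<2 ^ n. ennreal (w n * d n k \<omega> ^ q)) \<partial>M)"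
    unfolding S_def by (intro nn_integral_suminf level_meas)
  also have "\<dots> \<le> (\<Sum>n. ennreal (K * T powr r * \<rho> ^ n))" by (intro suminf_le level) auto
  also have "\<dots> < \<infinity>"
    using K \<rho> summable_mult[OF summable_geometric, of \<rho> "K * T powr r"]
    by (subst suminf_ennreal2) auto
  finally have fin: "(\<integral>\<^sup>+\<omega>. S \<omega> \<partial>M) < \<infinity>" .
  then have AEfin: "AE \<omega> in M. S \<omega> \<noteq> \<infinity>" by (intro nn_integral_PInf_AE) auto
  define C where "C = (2 + 2 / (1 - 2 powr - \<gamma>)) / T powr \<gamma>"
  have "2 powr - \<gamma> < (1::real)" using powr_less_mono[of "-\<gamma>" 0 2] \<gamma> by simp
  then have C: "0 \<le> C" unfolding C_def by auto
  \<comment> \<open>Where \<open>S\<close> is infinite, \<open>enn2real\<close> gives 0; this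
    concerns a null set, and there the Hoelder bound is not claimed.\<close>
  define R where "R = (\<lambda>\<omega>. enn2real (S \<omega>) powr (1 / q))"
  have Rq: "R \<omega> ^ q = enn2real (S \<omega>)" for \<omega>
    using q by (cases "enn2real (S \<omega>) = 0") (simp_all add: R_def powr_power)
  have "integrable M (\<lambda>\<omega>. enn2real (S \<omega>))"
  proof (rule integrableI_bounded)
    have "(\<integral>\<^sup>+\<omega>. ennreal (norm (enn2real (S \<omega>))) \<partial>M) \<le> (\<integral>\<^sup>+\<omega>. S \<omega> \<partial>M)"
      by (intro nn_integral_mono) (simp add: ennreal_enn2real_if)
    then show "(\<integral>\<^sup>+\<omega>. ennreal (norm (enn2real (S \<omega>))) \<partial>M) < \<infinity>" using fin by simp
  qed simp
  then have int: "integrable M (\<lambda>\<omega>. (C * R \<omega>) ^ q)" by (simp add: power_mult_distrib Rq)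
  have hold: "holder_bound \<gamma> 0 T (C * R \<omega>) (\<lambda>t. B t \<omega>)" if \<omega>: "\<omega> \<in> space M" "S \<omega> \<noteq> \<infinity>" for \<omega>
  proof -
    have "norm (B (T * (Suc k / 2 ^ n)) \<omega> - B (T * (k / 2 ^ n)) \<omega>) \<le> R \<omega> * (1 / 2 ^ n) powr \<gamma>"
      if k: "k < 2 ^ n" for n k
    proof -
      have "ennreal (w n * d n k \<omega> ^ q) \<le> (\<Sum>k<2 ^ n. ennreal (w n * d n k \<omega> ^ q))"
        using k by (intro member_le_sum) auto
      also have "\<dots> \<le> S \<omega>" unfolding S_def using sum_le_suminf[of "\<lambda>n. \<Sum>k<2 ^ n. ennreal (w n * d n k \<omega> ^ q)" "{n}"] by simp
      also have "\<dots> = ennreal (enn2real (S \<omega>))" using \<omega> by (simp add: top.not_eq_extremum)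
      finally have "w n * d n k \<omega> ^ q \<le> R \<omega> ^ q" unfolding Rq by (simp add: ennreal_le_iff)
      moreover have "w n = (2 powr (n * \<gamma>)) ^ q" unfolding w_def by (simp add: powr_power mult_ac)
      ultimately have "(2 powr (n * \<gamma>) * d n k \<omega>) ^ q \<le> R \<omega> ^ q" by (simp add: power_mult_distrib)
      then have "2 powr (n * \<gamma>) * d n k \<omega> \<le> R \<omega>"
        using q by (subst (asm) power_mono_iff) (auto simp: d_def R_def)
      then have "d n k \<omega> \<le> R \<omega> / 2 powr (n * \<gamma>)" by (subst pos_le_divide_eq) (simp_all add: mult.commute)
      also have "\<dots> = R \<omega> * (1 / 2 ^ n) powr \<gamma>"
        by (simp add: powr_divide powr_powr powr_realpow[symmetric])
      finally show ?thesis unfolding d_def .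
    qed
    from holder_bound_of_dyadic[OF T \<gamma> cont[OF \<omega>(1)] this] show ?thesis by (simp add: C_def)
  qed
  show ?thesis
  proof (intro exI[of _ "\<lambda>\<omega>. C * R \<omega>"] conjI allI)
    show "AE \<omega> in M. holder_bound \<gamma> 0 T (C * R \<omega>) (\<lambda>t. B t \<omega>)"
      using AEfin AE_space by eventually_elim (rule hold)
  qed (use int C in \<open>auto simp: R_def\<close>)
qed

section \<open>The pathwise estimate\<close>

text \<open>After time \<open>u\<close> a running maximum can grow by at most the oscillation of
  \<open>z\<close> since \<open>u\<close>, as the negative part is 1-Lipschitz. The factor
  \<open>CARD('d)\<close> comes from summing the components. Continuity makes the real suprema
  genuine.\<close>

lemma norm_regulator_diff_le:
  fixes z :: "real \<Rightarrow> real^'d" and L :: real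
  assumes cont: "continuous_on {0..v} z" and uv: "0 \<le> u" "u \<le> v"
    and L: "\<And>r. u \<le> r \<Longrightarrow> r \<le> v \<Longrightarrow> norm (z r - z u) \<le> L"
  shows "norm (regulator z v - regulator z u) \<le> CARD('d) * L"
proof -
  have "norm (regulator z v - regulator z u) \<le> (\<Sum>i\<in>UNIV. \<bar>(regulator z v - regulator z u) $ i\<bar>)"
    by (rule norm_le_l1_cart)
  also have "\<dots> \<le> (\<Sum>i\<in>(UNIV :: 'd set). L)"
  proof (rule sum_mono)
    fix i :: 'd
    define \<phi> where "\<phi> = (\<lambda>s. max (- (z s $ i)) 0)"
    have "continuous_on {0..v} \<phi>" unfolding \<phi>_def by (intro continuous_intros cont)
    then have bdd: "bdd_above (\<phi> ` {0..v})"
      by (intro bounded_imp_bdd_above compact_imp_bounded compact_continuous_image) auto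
    then have bddu: "bdd_above (\<phi> ` {0..u})" by (rule bdd_above_mono) (use uv in auto)
    have "(SUP s\<in>{0..u}. \<phi> s) \<le> (SUP s\<in>{0..v}. \<phi> s)"
      using uv bdd by (intro cSUP_subset_mono) auto
    moreover have "(SUP s\<in>{0..v}. \<phi> s) \<le> (SUP s\<in>{0..u}. \<phi> s) + L"
    proof (rule cSUP_least)
      fix s assume s: "s \<in> {0..v}"
      show "\<phi> s \<le> (SUP s\<in>{0..u}. \<phi> s) + L"
      proof (cases "s \<le> u")
        case True
        have "0 \<le> L" using order_trans[OF norm_ge_zero L[of u]] uv by simp
        moreover have "\<phi> s \<le> (SUP s\<in>{0..u}. \<phi> s)" using True s by (intro cSUP_upper bddu) auto
        ultimately show ?thesis by simp
      next
        case False
        have "\<bar>(z s - z u) $ i\<bar> \<le> L" using order_trans[OF component_le_norm_cart L[of s]] False s by simp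
        then have "\<phi> s \<le> \<phi> u + L" unfolding \<phi>_def by (auto simp: max_def)
        moreover have "\<phi> u \<le> (SUP s\<in>{0..u}. \<phi> s)" using uv by (intro cSUP_upper bddu) auto
        ultimately show ?thesis by simp
      qed
    qed (use uv in auto)
    ultimately show "\<bar>(regulator z v - regulator z u) $ i\<bar> \<le> L"
      by (simp add: regulator_def \<phi>_def)
  qed
  finally show ?thesis by simp
qed

text \<open>Each of the at most \<open>2 + T / \<Delta>\<close> pieces is bounded through the full
  length \<open>v - u\<close>, so passing to large scales costs just the number of pieces.\<close>

lemma holder_bound_of_local:
  fixes f :: "real \<Rightarrow> 'b::real_normed_vector"
  assumes T: "0 < T" and \<Delta>: "0 < \<Delta>" and \<alpha>: "0 \<le> \<alpha>"
    and loc: "\<And>u v. 0 \<le> u \<Longrightarrow> u \<le> v \<Longrightarrow> v \<le> T \<Longrightarrow> v - u \<le> \<Delta> \<Longrightarrow> norm (f v - f u) \<le> a * (v - u) powr \<alpha>"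
  shows "holder_bound \<alpha> 0 T ((2 + T / \<Delta>) * a) f"
  unfolding holder_bound_def
proof (intro allI impI)
  fix u v assume uv: "0 \<le> u" "u \<le> v" "v \<le> T"
  have "0 \<le> a * min T \<Delta> powr \<alpha>"
    using order_trans[OF norm_ge_zero loc[of 0 "min T \<Delta>"]] T \<Delta> by simp
  then have a: "0 \<le> a" using T \<Delta> by (simp add: zero_le_mult_iff min_def split: if_splits)
  have "norm (f v - f u) \<le> (2 + (v - u) / \<Delta>) * (a * (v - u) powr \<alpha>)"
  proof (rule norm_diff_cells_le)
    fix k :: nat and x y
    assume xy: "k * \<Delta> \<le> x" "x \<le> y" "y \<le> (real k + 1) * \<Delta>" "u \<le> x" "y \<le> v"
    then have "norm (f y - f x) \<le> a * (y - x) powr \<alpha>" using uv by (intro loc) (auto simp: algebra_simps)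
    also have "\<dots> \<le> a * (v - u) powr \<alpha>" using a xy \<alpha> by (intro mult_left_mono powr_mono2) auto
    finally show "norm (f y - f x) \<le> a * (v - u) powr \<alpha>" .
  qed (use uv \<Delta> in auto)
  also have "\<dots> \<le> (2 + T / \<Delta>) * (a * (v - u) powr \<alpha>)"
    using uv \<Delta> a by (intro mult_right_mono add_left_mono divide_right_mono) auto
  finally show "norm (f v - f u) \<le> (2 + T / \<Delta>) * a * (v - u) powr \<alpha>" by (simp add: mult.assoc)
qed

section \<open>A priori bound for a single path of the reflected equation\<close>

context
  fixes T \<alpha> \<gamma> \<nu> K\<^sub>0 Ms Mb :: real
    and \<sigma> :: "real \<Rightarrow> real^'d \<Rightarrow> real^'m^'d" and b :: "real \<Rightarrow> real^'d \<Rightarrow> real^'d"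
    and x0 :: "real^'d"
  assumes T: "T > 0" and K0: "K\<^sub>0 \<ge> 0"
    and \<alpha>: "0 < \<alpha>" "\<alpha> \<le> 1" "\<alpha> \<le> \<gamma>" "\<alpha> \<le> \<nu>" and \<gamma>: "1 / 2 \<le> \<gamma>" and \<theta>: "\<alpha> + \<gamma> > 1"
    and Ms: "\<And>t x. t \<in> {0..T} \<Longrightarrow> norm (\<sigma> t x) \<le> Ms"
    and Mb: "\<And>t x. t \<in> {0..T} \<Longrightarrow> norm (b t x) \<le> Mb"
    and \<sigma>x: "\<And>t x y. t \<in> {0..T} \<Longrightarrow> norm (\<sigma> t x - \<sigma> t y) \<le> K\<^sub>0 * norm (x - y)"
    and \<sigma>t: "\<And>s t x. s \<in> {0..T} \<Longrightarrow> t \<in> {0..T} \<Longrightarrow> norm (\<sigma> t x - \<sigma> s x) \<le> K\<^sub>0 * \<bar>t - s\<bar> powr \<nu>"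
begin

lemma sigma_bound_nonneg: "0 \<le> Ms"
  using order_trans[OF norm_ge_zero Ms[of 0]] T by simp

lemma drift_bound_nonneg: "0 \<le> Mb"
  using order_trans[OF norm_ge_zero Mb[of 0]] T by simp

text \<open>Stated on a subinterval so that a local Hoelder constant of \<open>x\<close> yields a
  local one for the integrand. The time exponent \<nu> is lowered to \<alpha> at the price
  \<open>T powr (\<nu> - \<alpha>)\<close>.\<close>

lemma holder_bound_coefficient:
  assumes x: "holder_bound \<alpha> p q a x" and pq: "0 \<le> p" "q \<le> T"
  shows "holder_bound \<alpha> p q (K\<^sub>0 * (T powr (\<nu> - \<alpha>) + a)) (\<lambda>s. \<sigma> s (x s))"
  unfolding holder_bound_def
proof (intro allI impI)
  fix u v assume uv: "p \<le> u" "u \<le> v" "v \<le> q"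
  have "norm (\<sigma> v (x v) - \<sigma> u (x u)) \<le> norm (\<sigma> v (x v) - \<sigma> v (x u)) + norm (\<sigma> v (x u) - \<sigma> u (x u))"
    using norm_triangle_ineq[of "\<sigma> v (x v) - \<sigma> v (x u)" "\<sigma> v (x u) - \<sigma> u (x u)"] by simp
  also have "\<dots> \<le> K\<^sub>0 * norm (x v - x u) + K\<^sub>0 * \<bar>v - u\<bar> powr \<nu>"
    using uv pq by (intro add_mono \<sigma>x \<sigma>t) auto
  also have "\<dots> \<le> K\<^sub>0 * (a * (v - u) powr \<alpha>) + K\<^sub>0 * (T powr (\<nu> - \<alpha>) * (v - u) powr \<alpha>)"
  proof (intro add_mono mult_left_mono K0)
    show "norm (x v - x u) \<le> a * (v - u) powr \<alpha>" using holder_boundD[OF x] uv by simp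
    have "\<bar>v - u\<bar> powr \<nu> = (v - u) powr (\<nu> - \<alpha>) * (v - u) powr \<alpha>"
      using uv by (simp add: powr_add[symmetric])
    also have "\<dots> \<le> T powr (\<nu> - \<alpha>) * (v - u) powr \<alpha>"
      using uv pq \<alpha> by (intro mult_right_mono powr_mono2) auto
    finally show "\<bar>v - u\<bar> powr \<nu> \<le> T powr (\<nu> - \<alpha>) * (v - u) powr \<alpha>" .
  qed
  finally show "norm (\<sigma> v (x v) - \<sigma> u (x u)) \<le> K\<^sub>0 * (T powr (\<nu> - \<alpha>) + a) * (v - u) powr \<alpha>"
    by (simp add: algebra_simps)
qed

lemma norm_drift_diff_le:
  assumes int: "set_integrable lebesgue {0..T} (\<lambda>s. b s (x s))" and uv: "0 \<le> u" "u \<le> v" "v \<le> T"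
  shows "norm ((LINT s:{0..v}|lebesgue. b s (x s)) - (LINT s:{0..u}|lebesgue. b s (x s))) \<le> Mb * (v - u)"
proof -
  have i: "set_integrable lebesgue {0..u} (\<lambda>s. b s (x s))" "set_integrable lebesgue {u<..v} (\<lambda>s. b s (x s))"
    by (rule set_integrable_subset[OF int]; use uv in auto)+
  have disj: "{0..u} \<inter> {u<..v} = {}" by auto
  have "{0..v} = {0..u} \<union> {u<..v}" using uv by auto
  then have "(LINT s:{0..v}|lebesgue. b s (x s)) =
      (LINT s:{0..u}|lebesgue. b s (x s)) + (LINT s:{u<..v}|lebesgue. b s (x s))"
    using set_integral_Un[OF disj i] by simp
  then have "norm ((LINT s:{0..v}|lebesgue. b s (x s)) - (LINT s:{0..u}|lebesgue. b s (x s)))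
      = norm (LINT s:{u<..v}|lebesgue. b s (x s))" by simp
  also have "\<dots> \<le> (LINT s|lebesgue. norm (indicator {u<..v} s *\<^sub>R b s (x s)))"
    unfolding set_lebesgue_integral_def by (rule integral_norm_bound)
  also have "\<dots> \<le> (LINT s|lebesgue. indicator {u<..v} s * Mb)"
  proof (rule integral_mono)
    show "integrable lebesgue (\<lambda>s. norm (indicator {u<..v} s *\<^sub>R b s (x s)))"
      using i(2) unfolding set_integrable_def by (rule integrable_norm)
    show "integrable lebesgue (\<lambda>s. indicator {u<..v} s * Mb)"
      using uv by (intro integrable_mult_left) (auto simp: integrable_indicator_iff)
    show "norm (indicator {u<..v} s *\<^sub>R b s (x s)) \<le> indicator {u<..v} s * Mb" for s
      using Mb[of s "x s"] uv by (auto simp: indicator_def)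
  qed
  also have "\<dots> = Mb * (v - u)" using uv by simp
  finally show ?thesis .
qed

text \<open>The global constant \<open>L\<close> ensures that the integrals from 0 exist; the
  estimate itself contains the constant \<open>a\<close> on \<open>[u, v]\<close>, as the absorption
  requires.\<close>

lemma norm_unreflected_diff_le:
  assumes x: "holder_bound \<alpha> 0 T L x" and w: "holder_bound \<gamma> 0 T G w"
    and int: "set_integrable lebesgue {0..T} (\<lambda>s. b s (x s))"
    and uv: "0 \<le> u" "u < v" "v \<le> T" and loc: "holder_bound \<alpha> u v a x"
  defines "Z \<equiv> unreflected_path x0 b \<sigma> w x"
  shows "norm (Z v - Z u) \<le> Mb * (v - u) + Ms * G * (v - u) powr \<gamma>
    + young_const (\<alpha> + \<gamma>) * (K\<^sub>0 * (T powr (\<nu> - \<alpha>) + a)) * G * (v - u) powr (\<alpha> + \<gamma>)"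
proof -
  let ?f = "\<lambda>s. \<sigma> s (x s)"
  let ?I = "\<lambda>t. young_integral 0 t ?f w"
  let ?B = "\<lambda>t. LINT s:{0..t}|lebesgue. b s (x s)"
  have young: "norm (?I v - ?I u - ?f u *v (w v - w u))
      \<le> young_const (\<alpha> + \<gamma>) * (K\<^sub>0 * (T powr (\<nu> - \<alpha>) + a)) * G * (v - u) powr (\<alpha> + \<gamma>)"
    using young_integral_increment[OF T holder_bound_coefficient[OF x] w _ _ \<theta> uv holder_bound_coefficient[OF loc]]
      uv \<alpha> \<gamma> by simp
  have "norm (?f u *v (w v - w u)) \<le> norm (?f u) * norm (w v - w u)" by (rule norm_matrix_vector_mult_le)
  also have "\<dots> \<le> Ms * (G * (v - u) powr \<gamma>)"
    using Ms[of u "x u"] holder_boundD[OF w, of u v] uv sigma_bound_nonneg by (intro mult_mono) auto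
  finally have "norm (?f u *v (w v - w u)) \<le> Ms * G * (v - u) powr \<gamma>" by (simp add: mult.assoc)
  moreover have "norm (?B v - ?B u) \<le> Mb * (v - u)" using norm_drift_diff_le[OF int] uv by simp
  moreover have "Z v - Z u = (?B v - ?B u) + (?f u *v (w v - w u) + (?I v - ?I u - ?f u *v (w v - w u)))"
    unfolding Z_def unreflected_path_def by simp
  ultimately show ?thesis using young norm_triangle_ineq norm_triangle_mono
    by (smt (verit, ccfv_SIG))
qed

text \<open>The supremum \<open>a\<close> of the Hoelder quotients at scale \<open>\<Delta>\<close> satisfies \<open>a \<le> \<dots> + (c + a) / 2\<close>. It is finite
  because \<open>x\<close> is assumed to be Hoelder, so it can be absorbed.\<close>

lemma reflected_local_holder_bound:
  fixes x :: "real \<Rightarrow> real^'d"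
  assumes x: "holder_bound \<alpha> 0 T L x" and w: "holder_bound \<gamma> 0 T G w"
    and int: "set_integrable lebesgue {0..T} (\<lambda>s. b s (x s))"
    and eq: "\<And>t. t \<in> {0..T} \<Longrightarrow> x t = unreflected_path x0 b \<sigma> w x t + regulator (unreflected_path x0 b \<sigma> w x) t"
    and \<Delta>: "0 < \<Delta>" and small: "2 * (1 + real CARD('d)) * young_const (\<alpha> + \<gamma>) * K\<^sub>0 * G * \<Delta> powr \<gamma> \<le> 1"
    and uv: "0 \<le> u" "u \<le> v" "v \<le> T" "v - u \<le> \<Delta>"
  shows "norm (x v - x u) \<le>
    (2 * (1 + real CARD('d)) * (Mb * T powr (1 - \<alpha>) + Ms * G * T powr (\<gamma> - \<alpha>)) + T powr (\<nu> - \<alpha>)) * (v - u) powr \<alpha>"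
proof -
  define Z where "Z = unreflected_path x0 b \<sigma> w x"
  define D where "D = 1 + real CARD('d)"
  \<comment> \<open>The pairs range over all of \<open>[0, T]\<close>, so one supremum serves every
    short interval simultaneously.\<close>
  define Q where "Q = {norm (x v - x u) / (v - u) powr \<alpha> | u v. 0 \<le> u \<and> u < v \<and> v \<le> T \<and> v - u \<le> \<Delta>}"
  define a where "a = Sup Q"
  define c where "c = T powr (\<nu> - \<alpha>)"
  have G: "0 \<le> G" using holder_bound_nonneg[OF w T] .
  have "bdd_above Q"
  proof (rule bdd_aboveI[of _ L])
    fix y assume "y \<in> Q"
    then obtain u v where "y = norm (x v - x u) / (v - u) powr \<alpha>" "0 \<le> u" "u < v" "v \<le> T"
      by (auto simp: Q_def)
    then show "y \<le> L" using holder_boundD[OF x, of u v] by (simp add: divide_le_eq)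
  qed
  moreover have "Q \<noteq> {}"
  proof -
    have "norm (x (min T \<Delta>) - x 0) / (min T \<Delta> - 0) powr \<alpha> \<in> Q"
      unfolding Q_def using T \<Delta> by (intro CollectI exI[of _ 0] exI[of _ "min T \<Delta>"]) auto
    then show ?thesis by auto
  qed
  ultimately have Q: "bdd_above Q" "Q \<noteq> {}" .
  have loc: "norm (x t - x s) \<le> a * (t - s) powr \<alpha>" if "0 \<le> s" "s \<le> t" "t \<le> T" "t - s \<le> \<Delta>" for s t
  proof (cases "s = t")
    case False
    have "norm (x t - x s) / (t - s) powr \<alpha> \<in> Q"
      unfolding Q_def mem_Collect_eq using that False by (intro exI[of _ s] exI[of _ t]) auto
    then have "norm (x t - x s) / (t - s) powr \<alpha> \<le> a"
      unfolding a_def by (intro cSup_upper Q(1))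
    then show ?thesis using that False by (simp add: divide_le_eq)
  qed simp
  have "0 \<le> a * min T \<Delta> powr \<alpha>"
    using order_trans[OF norm_ge_zero loc[of 0 "min T \<Delta>"]] T \<Delta> by simp
  then have a: "0 \<le> a" using T \<Delta> by (simp add: zero_le_mult_iff min_def split: if_splits)
  \<comment> \<open>An \<alpha>-Hoelder constant of \<open>Z\<close> at scale \<Delta>. In the Young
    term \<open>(t - s) powr \<gamma>\<close> is spent as \<open>\<Delta> powr \<gamma>\<close>, the
    small factor in front of \<open>a\<close>.\<close>
  define E where "E = Mb * T powr (1 - \<alpha>) + Ms * G * T powr (\<gamma> - \<alpha>)
      + young_const (\<alpha> + \<gamma>) * (K\<^sub>0 * (c + a)) * G * \<Delta> powr \<gamma>"
  have E: "0 \<le> E" unfolding E_def c_def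
    using drift_bound_nonneg sigma_bound_nonneg G a K0 young_const_nonneg[OF \<theta>] by (intro add_nonneg_nonneg mult_nonneg_nonneg) auto
  have Z: "norm (Z t - Z s) \<le> E * (t - s) powr \<alpha>" if st: "0 \<le> s" "s \<le> t" "t \<le> T" "t - s \<le> \<Delta>" for s t
  proof (cases "s = t")
    case False
    have "holder_bound \<alpha> s t a x" unfolding holder_bound_def using st by (auto intro!: loc)
    then have "norm (Z t - Z s) \<le> Mb * (t - s) + Ms * G * (t - s) powr \<gamma>
      + young_const (\<alpha> + \<gamma>) * (K\<^sub>0 * (c + a)) * G * (t - s) powr (\<alpha> + \<gamma>)"
      unfolding Z_def c_def using st False by (intro norm_unreflected_diff_le[OF x w int]) auto
    also have "\<dots> \<le> Mb * (T powr (1 - \<alpha>) * (t - s) powr \<alpha>) + Ms * G * (T powr (\<gamma> - \<alpha>) * (t - s) powr \<alpha>)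
      + young_const (\<alpha> + \<gamma>) * (K\<^sub>0 * (c + a)) * G * (\<Delta> powr \<gamma> * (t - s) powr \<alpha>)"
    proof (intro add_mono mult_left_mono)
      have "t - s = (t - s) powr (1 - \<alpha>) * (t - s) powr \<alpha>"
        using st False by (simp add: powr_add[symmetric])
      also have "\<dots> \<le> T powr (1 - \<alpha>) * (t - s) powr \<alpha>"
        using st \<alpha> by (intro mult_right_mono powr_mono2) auto
      finally show "t - s \<le> T powr (1 - \<alpha>) * (t - s) powr \<alpha>" .
      have "(t - s) powr \<gamma> = (t - s) powr (\<gamma> - \<alpha>) * (t - s) powr \<alpha>"
        using st False by (simp add: powr_add[symmetric])
      also have "\<dots> \<le> T powr (\<gamma> - \<alpha>) * (t - s) powr \<alpha>"
        using st \<alpha> by (intro mult_right_mono powr_mono2) auto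
      finally show "(t - s) powr \<gamma> \<le> T powr (\<gamma> - \<alpha>) * (t - s) powr \<alpha>" .
      have "(t - s) powr (\<alpha> + \<gamma>) = (t - s) powr \<gamma> * (t - s) powr \<alpha>"
        by (simp add: powr_add mult.commute)
      also have "\<dots> \<le> \<Delta> powr \<gamma> * (t - s) powr \<alpha>"
        using st \<alpha> \<gamma> by (intro mult_right_mono powr_mono2) auto
      finally show "(t - s) powr (\<alpha> + \<gamma>) \<le> \<Delta> powr \<gamma> * (t - s) powr \<alpha>" .
    qed (use drift_bound_nonneg sigma_bound_nonneg G K0 a young_const_nonneg[OF \<theta>] in \<open>auto simp: c_def\<close>)
    also have "\<dots> = E * (t - s) powr \<alpha>" unfolding E_def by (simp add: algebra_simps)
    finally show ?thesis .
  qed simp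
  \<comment> \<open>The regulator estimate needs continuity of \<open>Z\<close> back to time 0, so
    the short-scale bound is globalised; the size of the resulting constant is irrelevant
    here.\<close>
  have contZ: "continuous_on {0..T} Z"
    using holder_bound_imp_continuous_on[OF holder_bound_of_local[OF T \<Delta> _ Z]] \<alpha> by simp
  have X: "norm (x t - x s) \<le> D * E * (t - s) powr \<alpha>" if st: "0 \<le> s" "s \<le> t" "t \<le> T" "t - s \<le> \<Delta>" for s t
  proof -
    have "norm (regulator Z t - regulator Z s) \<le> CARD('d) * (E * (t - s) powr \<alpha>)"
    proof (rule norm_regulator_diff_le)
      show "continuous_on {0..t} Z" by (rule continuous_on_subset[OF contZ]) (use st in auto)
      fix r assume r: "s \<le> r" "r \<le> t"
      then have "norm (Z r - Z s) \<le> E * (r - s) powr \<alpha>" using st by (intro Z) auto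
      also have "\<dots> \<le> E * (t - s) powr \<alpha>" using r E \<alpha> by (intro mult_left_mono powr_mono2) auto
      finally show "norm (Z r - Z s) \<le> E * (t - s) powr \<alpha>" .
    qed (use st in auto)
    moreover have "x t - x s = (Z t - Z s) + (regulator Z t - regulator Z s)"
      using eq[of t] eq[of s] st unfolding Z_def by simp
    ultimately have "norm (x t - x s) \<le> E * (t - s) powr \<alpha> + CARD('d) * (E * (t - s) powr \<alpha>)"
      using Z[OF st] norm_triangle_ineq[of "Z t - Z s" "regulator Z t - regulator Z s"] by simp
    then show ?thesis unfolding D_def by (simp add: algebra_simps)
  qed
  have "a \<le> D * E" unfolding a_def
  proof (rule cSup_least[OF Q(2)])
    fix y assume "y \<in> Q"
    then obtain u v where "y = norm (x v - x u) / (v - u) powr \<alpha>" "0 \<le> u" "u < v" "v \<le> T" "v - u \<le> \<Delta>"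
      by (auto simp: Q_def)
    then show "y \<le> D * E" using X[of u v] by (simp add: divide_le_eq)
  qed
  \<comment> \<open>The unknown \<open>a\<close> is isolated with coefficient 1/2 times the quantity
    that the smallness assumption bounds by 1.\<close>
  also have "D * E = D * (Mb * T powr (1 - \<alpha>) + Ms * G * T powr (\<gamma> - \<alpha>))
      + (c + a) / 2 * (2 * D * young_const (\<alpha> + \<gamma>) * K\<^sub>0 * G * \<Delta> powr \<gamma>)"
    unfolding E_def by (simp add: algebra_simps)
  also have "\<dots> \<le> D * (Mb * T powr (1 - \<alpha>) + Ms * G * T powr (\<gamma> - \<alpha>)) + (c + a) / 2 * 1"
    using small a unfolding D_def c_def by (intro add_left_mono mult_left_mono) auto
  finally have "a \<le> D * (Mb * T powr (1 - \<alpha>) + Ms * G * T powr (\<gamma> - \<alpha>)) + (c + a) / 2 * 1" .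
  moreover have "a \<le> 2 * y + c" if "a \<le> y + (c + a) / 2 * 1" for y :: real
    using that by (simp add: field_simps)
  ultimately have "a \<le> 2 * D * (Mb * T powr (1 - \<alpha>) + Ms * G * T powr (\<gamma> - \<alpha>)) + c"
    unfolding mult.assoc[of 2 D] by blast
  then have "a * (v - u) powr \<alpha> \<le>
      (2 * D * (Mb * T powr (1 - \<alpha>) + Ms * G * T powr (\<gamma> - \<alpha>)) + c) * (v - u) powr \<alpha>"
    by (intro mult_right_mono) auto
  with loc[OF uv] show ?thesis unfolding D_def c_def by linarith
qed

text \<open>The constant is chosen before the paths and before \<open>L\<close>, hence is the same
  for all outcomes. Two powers of \<open>1 + G\<close> come from the number of short intervals, the
  third from the local constant, which is affine in \<open>G\<close>.\<close>

lemma reflected_seminorm_bound: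
  "\<exists>C\<ge>0. \<forall>x w L G. holder_bound \<alpha> 0 T L x \<longrightarrow> holder_bound \<gamma> 0 T G w \<longrightarrow>
    set_integrable lebesgue {0..T} (\<lambda>s. b s (x s)) \<longrightarrow>
    (\<forall>t\<in>{0..T}. x t = unreflected_path x0 b \<sigma> w x t + regulator (unreflected_path x0 b \<sigma> w x) t) \<longrightarrow>
    holder_seminorm \<alpha> 0 T x \<le> C * (1 + G) ^ 3"
proof -
  define N where "N = 2 * (1 + real CARD('d))"
  \<comment> \<open>The summand 1 gives \<open>\<kappa> * (1 + G) \<ge> 1\<close>, so this base is
    positive and its powers increase with the exponent.\<close>
  define \<kappa> where "\<kappa> = N * young_const (\<alpha> + \<gamma>) * K\<^sub>0 + 1"
  define A where "A = N * (Mb * T powr (1 - \<alpha>) + Ms * T powr (\<gamma> - \<alpha>)) + T powr (\<nu> - \<alpha>)"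
  have N: "0 \<le> N" by (simp add: N_def)
  have \<kappa>: "1 \<le> \<kappa>" unfolding \<kappa>_def using N K0 young_const_nonneg[OF \<theta>] by simp
  have A: "0 \<le> A" unfolding A_def using N drift_bound_nonneg sigma_bound_nonneg by simp
  show ?thesis
  proof (intro exI[of _ "(2 + T * \<kappa>\<^sup>2) * A"] conjI allI impI)
    show "0 \<le> (2 + T * \<kappa>\<^sup>2) * A" using A T by simp
    fix x :: "real \<Rightarrow> real^'d" and w L G
    assume x: "holder_bound \<alpha> 0 T L x" and w: "holder_bound \<gamma> 0 T G w"
      and int: "set_integrable lebesgue {0..T} (\<lambda>s. b s (x s))"
      and eq: "\<forall>t\<in>{0..T}. x t = unreflected_path x0 b \<sigma> w x t + regulator (unreflected_path x0 b \<sigma> w x) t"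
    have G: "0 \<le> G" using holder_bound_nonneg[OF w T] .
    have \<kappa>G: "1 \<le> \<kappa> * (1 + G)" using mult_mono[of 1 \<kappa> 1 "1 + G"] \<kappa> G by simp
    \<comment> \<open>Solves \<open>\<Delta> powr \<gamma> = 1 / (\<kappa> * (1 + G))\<close>, which
      is what the smallness condition asks for.\<close>
    define \<Delta> where "\<Delta> = (\<kappa> * (1 + G)) powr (- 1 / \<gamma>)"
    have \<Delta>: "0 < \<Delta>" unfolding \<Delta>_def using \<kappa> G by simp
    have "\<Delta> powr \<gamma> = (\<kappa> * (1 + G)) powr - 1"
      unfolding \<Delta>_def powr_powr using \<gamma> by simp
    then have "\<Delta> powr \<gamma> = 1 / (\<kappa> * (1 + G))"
      using \<kappa>G by (simp add: powr_minus_divide)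
    moreover have "N * young_const (\<alpha> + \<gamma>) * K\<^sub>0 * G \<le> \<kappa> * (1 + G)"
      using N K0 young_const_nonneg[OF \<theta>] G unfolding \<kappa>_def by (intro mult_mono) auto
    ultimately have small: "N * young_const (\<alpha> + \<gamma>) * K\<^sub>0 * G * \<Delta> powr \<gamma> \<le> 1"
      using \<kappa>G by (simp add: divide_le_eq)
    define a where "a = N * (Mb * T powr (1 - \<alpha>) + Ms * G * T powr (\<gamma> - \<alpha>)) + T powr (\<nu> - \<alpha>)"
    have "norm (x v - x u) \<le> a * (v - u) powr \<alpha>" if "0 \<le> u" "u \<le> v" "v \<le> T" "v - u \<le> \<Delta>" for u v
      using reflected_local_holder_bound[OF x w int _ \<Delta> small[unfolded N_def] that] eq
      unfolding a_def N_def by blast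
    then have "holder_bound \<alpha> 0 T ((2 + T / \<Delta>) * a) x"
      using \<alpha> by (intro holder_bound_of_local T \<Delta>) auto
    then have "holder_seminorm \<alpha> 0 T x \<le> (2 + T / \<Delta>) * a" by (rule holder_seminorm_le[OF T])
    also have "\<dots> \<le> ((2 + T * \<kappa>\<^sup>2) * (1 + G)\<^sup>2) * (A * (1 + G))"
    proof (rule mult_mono)
      have "1 / \<Delta> = (\<kappa> * (1 + G)) powr (1 / \<gamma>)"
        unfolding \<Delta>_def using \<kappa>G by (simp add: powr_minus_divide)
      also have "\<dots> \<le> (\<kappa> * (1 + G)) powr 2"
        using \<kappa>G \<gamma> by (intro powr_mono) (auto simp: divide_le_eq)
      also have "\<dots> = \<kappa>\<^sup>2 * (1 + G)\<^sup>2" using \<kappa>G by (simp add: powr_numeral power_mult_distrib)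
      finally have "T * (1 / \<Delta>) \<le> T * (\<kappa>\<^sup>2 * (1 + G)\<^sup>2)" using T by (intro mult_left_mono) auto
      moreover have "1 \<le> (1 + G)\<^sup>2" using G by simp
      ultimately show "2 + T / \<Delta> \<le> (2 + T * \<kappa>\<^sup>2) * (1 + G)\<^sup>2" by (simp add: algebra_simps)
      have "a \<le> N * (Mb * T powr (1 - \<alpha>) * (1 + G) + Ms * T powr (\<gamma> - \<alpha>) * (1 + G)) + T powr (\<nu> - \<alpha>) * (1 + G)"
        unfolding a_def
      proof (intro add_mono mult_left_mono N)
        show "Mb * T powr (1 - \<alpha>) \<le> Mb * T powr (1 - \<alpha>) * (1 + G)"
          using drift_bound_nonneg G by (simp add: distrib_left)
        show "Ms * G * T powr (\<gamma> - \<alpha>) \<le> Ms * T powr (\<gamma> - \<alpha>) * (1 + G)"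
          using sigma_bound_nonneg G by (simp add: algebra_simps)
        show "T powr (\<nu> - \<alpha>) \<le> T powr (\<nu> - \<alpha>) * (1 + G)" using G by (simp add: distrib_left)
      qed
      also have "\<dots> = A * (1 + G)" unfolding A_def by (simp add: algebra_simps)
      finally show "a \<le> A * (1 + G)" .
      show "0 \<le> a" unfolding a_def using N drift_bound_nonneg sigma_bound_nonneg G by simp
    qed (use T in auto)
    also have "\<dots> = (2 + T * \<kappa>\<^sup>2) * A * (1 + G) ^ 3" by (simp add: power2_eq_square power3_eq_cube)
    finally show "holder_seminorm \<alpha> 0 T x \<le> (2 + T * \<kappa>\<^sup>2) * A * (1 + G) ^ 3" .
  qed
qed

end

section \<open>Moments of fractional Brownian motion\<close>

text \<open>The factor is the double factorial of \<open>2 * k - 1\<close>, from the normal moment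
  formula. The degenerate case is a constant, which the mean forces to be 0.\<close>

lemma gaussian_even_moment:
  assumes "prob_space M" and X: "gaussian_variable M X" and mean: "integral\<^sup>L M X = 0"
  shows "integrable M (\<lambda>\<omega>. X \<omega> ^ (2 * k))"
    and "(LINT \<omega>|M. X \<omega> ^ (2 * k)) \<le> fact (2 * k) / (2 ^ k * fact k) * (LINT \<omega>|M. X \<omega> ^ 2) ^ k"
proof -
  interpret prob_space M by fact
  have [measurable]: "X \<in> borel_measurable M" using X by (simp add: gaussian_variable_def)
  consider \<mu> where "AE \<omega> in M. X \<omega> = \<mu>"
    | \<mu> s where "s > 0" "distributed M lborel X (\<lambda>x. ennreal (normal_density \<mu> s x))"
    using X unfolding gaussian_variable_def by blast
  then have "integrable M (\<lambda>\<omega>. X \<omega> ^ (2 * k)) \<and>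
    (LINT \<omega>|M. X \<omega> ^ (2 * k)) \<le> fact (2 * k) / (2 ^ k * fact k) * (LINT \<omega>|M. X \<omega> ^ 2) ^ k"
  proof cases
    case 1
    have "integral\<^sup>L M X = (LINT \<omega>|M. \<mu>)" by (rule integral_cong_AE) (use 1 in auto)
    then have "\<mu> = 0" using mean by (simp add: prob_space)
    with 1 have AE: "AE \<omega> in M. X \<omega> = 0" by simp
    have pow: "AE \<omega> in M. X \<omega> ^ n = 0 ^ n" for n using AE by eventually_elim simp
    have int: "integrable M (\<lambda>\<omega>. X \<omega> ^ (2 * k)) = integrable M (\<lambda>\<omega>. 0 ^ (2 * k) :: real)"
      by (rule integrable_cong_AE) (use pow in auto)
    have zero: "(LINT \<omega>|M. X \<omega> ^ n) = 0 ^ n" for n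
    proof -
      have "(LINT \<omega>|M. X \<omega> ^ n) = (LINT \<omega>|M. 0 ^ n)" by (rule integral_cong_AE) (use pow in auto)
      then show ?thesis by (simp add: prob_space)
    qed
    \<comment> \<open>For \<open>k = 0\<close> both sides are 1, since \<open>0 ^ 0 = 1\<close>;
      otherwise both are 0.\<close>
    have "(LINT \<omega>|M. X \<omega> ^ (2 * k)) \<le> fact (2 * k) / (2 ^ k * fact k) * (LINT \<omega>|M. X \<omega> ^ 2) ^ k"
      unfolding zero by (cases k) simp_all
    with int show ?thesis by simp
  next
    case 2
    note D = 2(2)
    have "\<mu> = 0" using normal_distributed_expectation[OF 2] mean by simp
    have eq: "has_bochner_integral lborel (\<lambda>x. normal_density \<mu> s x * x ^ (2 * n))
        (fact (2 * n) / ((2 / s\<^sup>2) ^ n * fact n))" for n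
      using normal_moment_even[OF 2(1), of 0 n] \<open>\<mu> = 0\<close> by simp
    have int: "integrable M (\<lambda>\<omega>. X \<omega> ^ (2 * n))" for n
      using distributed_integrable[OF D, of "\<lambda>x. x ^ (2 * n)"] eq[of n] has_bochner_integral_iff by auto
    have val: "(LINT \<omega>|M. X \<omega> ^ (2 * n)) = fact (2 * n) / ((2 / s\<^sup>2) ^ n * fact n)" for n
      using distributed_integral[OF D, of "\<lambda>x. x ^ (2 * n)"] has_bochner_integral_integral_eq[OF eq[of n]] by simp
    have "(LINT \<omega>|M. X \<omega> ^ 2) = s\<^sup>2" using val[of 1] by (simp add: fact_numeral)
    then show ?thesis using int[of k] val[of k] by (simp add: power_divide)
  qed
  then show "integrable M (\<lambda>\<omega>. X \<omega> ^ (2 * k))"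
    "(LINT \<omega>|M. X \<omega> ^ (2 * k)) \<le> fact (2 * k) / (2 ^ k * fact k) * (LINT \<omega>|M. X \<omega> ^ 2) ^ k" by auto
qed

lemma fractional_brownian_motion_gaussian:
  assumes "fractional_brownian_motion M I H B" "t \<in> I"
  shows "gaussian_variable M (B t)"
proof -
  have "\<forall>J c. finite J \<and> J \<subseteq> I \<longrightarrow> gaussian_variable M (\<lambda>\<omega>. \<Sum>t\<in>J. c t * B t \<omega>)"
    using assms(1) unfolding fractional_brownian_motion_def gaussian_process_def by blast
  from this[rule_format, of "{t}" "\<lambda>_. 1"] show ?thesis using assms(2) by simp
qed

text \<open>Expanding the square and inserting the covariance cancels all terms but
  \<open>\<bar>t - s\<bar> powr (2 * H)\<close>. Splitting the integral needs integrability of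
  squares, from Gaussianity, and of the product, which the squares dominate.\<close>

lemma fractional_brownian_motion_increment:
  assumes "prob_space M" and B: "fractional_brownian_motion M I H B" and st: "s \<in> I" "t \<in> I" "0 \<le> s" "0 \<le> t"
  shows "gaussian_variable M (\<lambda>\<omega>. B t \<omega> - B s \<omega>)"
    and "(LINT \<omega>|M. B t \<omega> - B s \<omega>) = 0"
    and "(LINT \<omega>|M. (B t \<omega> - B s \<omega>)\<^sup>2) = \<bar>t - s\<bar> powr (2 * H)"
proof -
  interpret prob_space M by fact
  have gauss: "gaussian_variable M (\<lambda>\<omega>. \<Sum>t\<in>J. c t * B t \<omega>)" if "finite J" "J \<subseteq> I" for J c
    using B that unfolding fractional_brownian_motion_def gaussian_process_def by blast
  have gauss1: "gaussian_variable M (B r)" if "r \<in> I" for r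
    using fractional_brownian_motion_gaussian[OF B that] .
  have mean: "integral\<^sup>L M (B r) = 0" if "r \<in> I" for r
    using B that unfolding fractional_brownian_motion_def by blast
  have cov: "(LINT \<omega>|M. B p \<omega> * B r \<omega>) = (p powr (2 * H) + r powr (2 * H) - \<bar>r - p\<bar> powr (2 * H)) / 2"
    if "p \<in> I" "r \<in> I" for p r
    using B that unfolding fractional_brownian_motion_def by blast
  have meas [measurable]: "B r \<in> borel_measurable M" if "r \<in> I" for r
    using gauss1[OF that] by (simp add: gaussian_variable_def)
  have sq: "integrable M (\<lambda>\<omega>. (B r \<omega>)\<^sup>2)" if "r \<in> I" for r
    using gaussian_even_moment(1)[OF assms(1) gauss1[OF that] mean[OF that], of 1] by simp
  have int: "integrable M (B r)" if "r \<in> I" for r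
    using square_integrable_imp_integrable[OF meas[OF that] sq[OF that]] .
  have prod: "integrable M (\<lambda>\<omega>. B s \<omega> * B t \<omega>)"
  proof (rule Bochner_Integration.integrable_bound)
    show "integrable M (\<lambda>\<omega>. (B s \<omega>)\<^sup>2 + (B t \<omega>)\<^sup>2)" using sq st by auto
    show "AE \<omega> in M. norm (B s \<omega> * B t \<omega>) \<le> norm ((B s \<omega>)\<^sup>2 + (B t \<omega>)\<^sup>2)"
    proof (rule AE_I2)
      fix \<omega>
      have "2 * (\<bar>B s \<omega>\<bar> * \<bar>B t \<omega>\<bar>) \<le> (B s \<omega>)\<^sup>2 + (B t \<omega>)\<^sup>2"
        using sum_squares_bound[of "\<bar>B s \<omega>\<bar>" "\<bar>B t \<omega>\<bar>"] by simp
      moreover have "0 \<le> \<bar>B s \<omega>\<bar> * \<bar>B t \<omega>\<bar>" by simp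
      ultimately have "\<bar>B s \<omega>\<bar> * \<bar>B t \<omega>\<bar> \<le> (B s \<omega>)\<^sup>2 + (B t \<omega>)\<^sup>2" by linarith
      then show "norm (B s \<omega> * B t \<omega>) \<le> norm ((B s \<omega>)\<^sup>2 + (B t \<omega>)\<^sup>2)"
        by (simp add: abs_mult)
    qed
  qed (use st in measurable)
  show "(LINT \<omega>|M. B t \<omega> - B s \<omega>) = 0" using int mean st by simp
  have "(LINT \<omega>|M. (B t \<omega> - B s \<omega>)\<^sup>2) = (LINT \<omega>|M. (B t \<omega>)\<^sup>2 - 2 * (B s \<omega> * B t \<omega>) + (B s \<omega>)\<^sup>2)"
    by (intro Bochner_Integration.integral_cong) (auto simp: power2_eq_square algebra_simps)
  also have "\<dots> = (LINT \<omega>|M. (B t \<omega>)\<^sup>2) - 2 * (LINT \<omega>|M. B s \<omega> * B t \<omega>) + (LINT \<omega>|M. (B s \<omega>)\<^sup>2)"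
    using sq prod st by simp
  also have "\<dots> = \<bar>t - s\<bar> powr (2 * H)"
    using cov[of s t] cov[of s s] cov[of t t] st by (simp add: power2_eq_square)
  finally show "(LINT \<omega>|M. (B t \<omega> - B s \<omega>)\<^sup>2) = \<bar>t - s\<bar> powr (2 * H)" .
  show "gaussian_variable M (\<lambda>\<omega>. B t \<omega> - B s \<omega>)"
  proof (cases "s = t")
    case True
    then show ?thesis by (auto simp: gaussian_variable_def)
  next
    case False
    \<comment> \<open>The weights produce the difference because \<open>{s, t}\<close> has two
      elements; for \<open>s = t\<close> the increment is the degenerate Gaussian 0.\<close>
    then show ?thesis using gauss[of "{s, t}" "\<lambda>r. if r = t then 1 else - 1"] st by simp
  qed
qed

text \<open>The moment of order \<open>2 * k\<close> of an increment scales like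
  \<open>\<bar>t - s\<bar> powr (2 * k * H)\<close>. Kolmogorov's condition then reads
  \<open>2 * k * (H - \<gamma>) > 1\<close>, so higher moments allow \<gamma> closer to
  \<open>H\<close>.\<close>

lemma fractional_brownian_motion_holder_moment:
  assumes "prob_space M" and T: "T > 0" and B: "fractional_brownian_motion M {0..T} H B"
    and cont: "\<And>\<omega>. \<omega> \<in> space M \<Longrightarrow> continuous_on {0..T} (\<lambda>t. B t \<omega>)"
    and \<gamma>: "0 < \<gamma>" and k: "2 * real k * (H - \<gamma>) > 1"
  shows "\<exists>G. G \<in> borel_measurable M \<and> (\<forall>\<omega>. 0 \<le> G \<omega>) \<and> integrable M (\<lambda>\<omega>. G \<omega> ^ (2 * k)) \<and>
    (AE \<omega> in M. holder_bound \<gamma> 0 T (G \<omega>) (\<lambda>t. B t \<omega>))"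
proof -
  interpret prob_space M by fact
  define K :: real where "K = fact (2 * k) / (2 ^ k * fact k)"
  have k0: "k > 0" using k by (cases k) auto
  show ?thesis
  proof (rule kolmogorov_holder_moment[OF T \<gamma>, where r = "2 * real k * H" and K = K])
    show "1 + \<gamma> * real (2 * k) < 2 * real k * H" using k by (simp add: algebra_simps)
    show "B t \<in> borel_measurable M" if "t \<in> {0..T}" for t
      using fractional_brownian_motion_gaussian[OF B that] by (simp add: gaussian_variable_def)
    fix s t assume st: "s \<in> {0..T}" "t \<in> {0..T}"
    note inc = fractional_brownian_motion_increment[OF assms(1) B st]
    have "0 \<le> s" "0 \<le> t" using st by auto
    note m = gaussian_even_moment[OF assms(1) inc(1,2), OF this this, of k]
    have "(\<integral>\<^sup>+\<omega>. ennreal (norm (B t \<omega> - B s \<omega>) ^ (2 * k)) \<partial>M) = (\<integral>\<^sup>+\<omega>. ennreal ((B t \<omega> - B s \<omega>) ^ (2 * k)) \<partial>M)"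
      by (simp add: power_even_abs)
    also have "\<dots> = ennreal (LINT \<omega>|M. (B t \<omega> - B s \<omega>) ^ (2 * k))"
      using m(1) by (intro nn_integral_eq_integral) auto
    also have "\<dots> \<le> ennreal (K * (\<bar>t - s\<bar> powr (2 * H)) ^ k)"
      using m(2) inc(3) st unfolding K_def by (intro ennreal_leI) auto
    also have "(\<bar>t - s\<bar> powr (2 * H)) ^ k = \<bar>t - s\<bar> powr (2 * real k * H)"
      using k0 by (cases "t = s") (auto simp: powr_power mult_ac)
    finally show "(\<integral>\<^sup>+\<omega>. ennreal (norm (B t \<omega> - B s \<omega>) ^ (2 * k)) \<partial>M) \<le> ennreal (K * \<bar>t - s\<bar> powr (2 * real k * H))" .
  qed (use cont k0 in \<open>auto simp: K_def\<close>)
qed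

section \<open>Measurability of the Hoelder seminorm\<close>

text \<open>Continuity in the index reduces the supremum to a countable dense subset of
  \<open>P\<close>.\<close>

lemma borel_measurable_cSUP_separable:
  fixes q :: "'b::{metric_space, second_countable_topology} \<Rightarrow> 'a \<Rightarrow> real"
  assumes P: "P \<noteq> {}" and meas: "\<And>z. z \<in> P \<Longrightarrow> q z \<in> borel_measurable M"
    and cont: "\<And>\<omega>. \<omega> \<in> space M \<Longrightarrow> continuous_on P (\<lambda>z. q z \<omega>)"
    and bdd: "\<And>\<omega>. \<omega> \<in> space M \<Longrightarrow> bdd_above ((\<lambda>z. q z \<omega>) ` P)"
  shows "(\<lambda>\<omega>. SUP z\<in>P. q z \<omega>) \<in> borel_measurable M"
proof -
  obtain I where I: "countable I" "I \<subseteq> P" "P \<subseteq> closure I" using separable[of P] by blast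
  have I0: "I \<noteq> {}" using I P by auto
  have bddI: "bdd_above ((\<lambda>z. q z \<omega>) ` I)" if "\<omega> \<in> space M" for \<omega>
    using bdd[OF that] by (rule bdd_above_mono) (use I in auto)
  have "(SUP z\<in>P. q z \<omega>) = (SUP z\<in>I. q z \<omega>)" if \<omega>: "\<omega> \<in> space M" for \<omega>
  proof (rule antisym)
    show "(SUP z\<in>P. q z \<omega>) \<le> (SUP z\<in>I. q z \<omega>)"
    proof (rule cSUP_least[OF P])
      fix z assume z: "z \<in> P"
      then obtain y where y: "\<And>n. y n \<in> I" "y \<longlonglongrightarrow> z"
        using I closure_sequential[of z I] by blast
      have "(\<lambda>n. q (y n) \<omega>) \<longlonglongrightarrow> q z \<omega>"
        by (rule continuous_on_tendsto_compose[OF cont[OF \<omega>] y(2) z]) (use y I in \<open>auto intro!: always_eventually\<close>)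
      then show "q z \<omega> \<le> (SUP z\<in>I. q z \<omega>)"
        by (rule LIMSEQ_le_const2) (use y in \<open>auto intro!: cSUP_upper bddI \<omega>\<close>)
    qed
    show "(SUP z\<in>I. q z \<omega>) \<le> (SUP z\<in>P. q z \<omega>)"
      by (rule cSUP_subset_mono[OF I0 bdd[OF \<omega>]]) (use I in auto)
  qed
  moreover have "(\<lambda>\<omega>. SUP z\<in>I. q z \<omega>) \<in> borel_measurable M"
    using I meas bddI by (intro borel_measurable_cSUP) auto
  ultimately show ?thesis by (simp cong: measurable_cong)
qed

text \<open>Only evaluations are known to be measurable. The quotients are continuous in the pair
  \<open>(u, v)\<close> off the diagonal, so the supremum over the uncountable set of pairs is
  measurable.\<close>

lemma borel_measurable_holder_seminorm:
  fixes X :: "real \<Rightarrow> 'a \<Rightarrow> real^'d"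
  assumes T: "T > 0" and \<alpha>: "\<alpha> > 0" and X: "holder_random_variable M \<alpha> T X"
  shows "(\<lambda>\<omega>. holder_seminorm \<alpha> 0 T (\<lambda>t. X t \<omega>)) \<in> borel_measurable M"
proof -
  define P where "P = {z :: real \<times> real. 0 \<le> fst z \<and> fst z < snd z \<and> snd z \<le> T}"
  define q where "q = (\<lambda>z \<omega>. norm (X (snd z) \<omega> - X (fst z) \<omega>) / (snd z - fst z) powr \<alpha>)"
  have quot: "holder_quotients \<alpha> 0 T (\<lambda>t. X t \<omega>) = (\<lambda>z. q z \<omega>) ` P" for \<omega>
  proof (intro set_eqI iffI)
    fix y assume "y \<in> holder_quotients \<alpha> 0 T (\<lambda>t. X t \<omega>)"
    then obtain u v where "y = q (u, v) \<omega>" "(u, v) \<in> P"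
      by (auto simp: holder_quotients_def P_def q_def)
    then show "y \<in> (\<lambda>z. q z \<omega>) ` P" by blast
  next
    fix y assume "y \<in> (\<lambda>z. q z \<omega>) ` P"
    then obtain u v where "(u, v) \<in> P" "y = q (u, v) \<omega>" by (metis imageE prod.collapse)
    then show "y \<in> holder_quotients \<alpha> 0 T (\<lambda>t. X t \<omega>)"
      unfolding holder_quotients_def mem_Collect_eq
      by (intro exI[of _ u] exI[of _ v]) (auto simp: P_def q_def)
  qed
  have space: "(\<lambda>t. X t \<omega>) \<in> holder_space \<alpha> 0 T" if "\<omega> \<in> space M" for \<omega>
    using X that by (simp add: holder_random_variable_def)
  have "(\<lambda>\<omega>. SUP z\<in>P. q z \<omega>) \<in> borel_measurable M"
  proof (rule borel_measurable_cSUP_separable)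
    have "(0, T) \<in> P" using T by (simp add: P_def)
    then show "P \<noteq> {}" by auto
    show "q z \<in> borel_measurable M" if "z \<in> P" for z
    proof -
      have [measurable]: "X (snd z) \<in> borel_measurable M" "X (fst z) \<in> borel_measurable M"
        using X that by (auto simp: P_def holder_random_variable_def)
      show ?thesis unfolding q_def by measurable
    qed
    fix \<omega> assume \<omega>: "\<omega> \<in> space M"
    have c: "continuous_on {0..T} (\<lambda>t. X t \<omega>)"
      by (rule holder_bound_imp_continuous_on[OF holder_bound_of_holder_space[OF space[OF \<omega>]] \<alpha>])
    show "continuous_on P (\<lambda>z. q z \<omega>)"
      unfolding q_def
      by (intro continuous_intros continuous_on_compose2[OF c]) (auto simp: P_def)
    show "bdd_above ((\<lambda>z. q z \<omega>) ` P)" using space[OF \<omega>] quot by (simp add: holder_space_def)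
  qed
  then show ?thesis by (simp add: holder_seminorm_def quot)
qed

section \<open>Moments of the solution\<close>

text \<open>A sum is at most its number of terms times the largest term. Positivity of
  \<open>q\<close> matters for empty \<open>A\<close>, where \<open>0 ^ 0 = 1\<close>.\<close>

lemma sum_power_le:
  fixes a :: "'i \<Rightarrow> real"
  assumes "finite A" and a: "\<And>i. i \<in> A \<Longrightarrow> 0 \<le> a i" and q: "q > 0"
  shows "(\<Sum>i\<in>A. a i) ^ q \<le> real (card A) ^ q * (\<Sum>i\<in>A. a i ^ q)"
proof (cases "A = {}")
  case False
  define m where "m = Max (a ` A)"
  have "m \<in> a ` A" unfolding m_def using assms False by (intro Max_in) auto
  then obtain j where j: "j \<in> A" "m = a j" by blast
  have "(\<Sum>i\<in>A. a i) \<le> real (card A) * m"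
    using assms by (intro sum_bounded_above) (auto simp: m_def)
  then have "(\<Sum>i\<in>A. a i) ^ q \<le> (real (card A) * m) ^ q" using a by (intro power_mono sum_nonneg) auto
  also have "\<dots> = real (card A) ^ q * a j ^ q" by (simp add: power_mult_distrib j)
  also have "\<dots> \<le> real (card A) ^ q * (\<Sum>i\<in>A. a i ^ q)"
    using assms j by (intro mult_left_mono member_le_sum) auto
  finally show ?thesis .
qed (use q in \<open>simp add: zero_power\<close>)

theorem theorem2p2:
  fixes M :: "'a measure"
    and T H K\<^sub>0 \<nu> \<alpha> :: real
    and W :: "real \<Rightarrow> 'a \<Rightarrow> real^'m"
    and x0 :: "real^'d"
    and \<sigma> :: "real \<Rightarrow> real^'d \<Rightarrow> real^'m^'d"
    and b :: "real \<Rightarrow> real^'d \<Rightarrow> real^'d"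
    and X :: "real \<Rightarrow> 'a \<Rightarrow> real^'d"
  assumes "prob_space M" and "complete_measure M"
    and "T > 0" and "1 / 2 < H" and "H < 1"
    and "\<And>j. fractional_brownian_motion M {0..T} H (\<lambda>t \<omega>. W t \<omega> $ j)"
    and "independent_components M {0..T} W"
    and "\<And>\<omega>. \<omega> \<in> space M \<Longrightarrow> continuous_on {0..T} (\<lambda>t. W t \<omega>)"
    and "\<And>i. x0 $ i > 0"
    and "bounded {\<sigma> t x | t x. t \<in> {0..T}}"
    and "bounded {b t x | t x. t \<in> {0..T}}"
    and "K\<^sub>0 \<ge> 0" and "\<nu> \<ge> H"
    and "\<And>t x y. t \<in> {0..T} \<Longrightarrow> norm (\<sigma> t x - \<sigma> t y) \<le> K\<^sub>0 * norm (x - y)"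
    and "\<And>s t x. s \<in> {0..T} \<Longrightarrow> t \<in> {0..T} \<Longrightarrow> norm (\<sigma> t x - \<sigma> s x) \<le> K\<^sub>0 * \<bar>t - s\<bar> powr \<nu>"
    and "\<And>t x y. t \<in> {0..T} \<Longrightarrow> norm (b t x - b t y) \<le> K\<^sub>0 * norm (x - y)"
    and "1 / 2 < \<alpha>" and "\<alpha> < H"
    and "reflected_sde_solution M T \<alpha> x0 b \<sigma> W X"
  shows "\<forall>p\<ge>1. integrable M (\<lambda>\<omega>. holder_seminorm \<alpha> 0 T (\<lambda>t. X t \<omega>) powr p)"
proof (intro allI impI)
  fix p :: real assume p: "p \<ge> 1"
  interpret prob_space M by fact
  define \<gamma> where "\<gamma> = (\<alpha> + H) / 2"
  have \<gamma>: "1 / 2 < \<gamma>" "\<alpha> < \<gamma>" "\<gamma> < H" using assms unfolding \<gamma>_def by auto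
  obtain Ms where Ms: "\<And>t x. t \<in> {0..T} \<Longrightarrow> norm (\<sigma> t x) \<le> Ms"
    using assms(10) unfolding bounded_iff by blast
  obtain Mb where Mb: "\<And>t x. t \<in> {0..T} \<Longrightarrow> norm (b t x) \<le> Mb"
    using assms(11) unfolding bounded_iff by blast
  have "\<exists>C\<ge>0. \<forall>x w L G. holder_bound \<alpha> 0 T L x \<longrightarrow> holder_bound \<gamma> 0 T G w \<longrightarrow>
    set_integrable lebesgue {0..T} (\<lambda>s. b s (x s)) \<longrightarrow>
    (\<forall>t\<in>{0..T}. x t = unreflected_path x0 b \<sigma> w x t + regulator (unreflected_path x0 b \<sigma> w x) t) \<longrightarrow>
    holder_seminorm \<alpha> 0 T x \<le> C * (1 + G) ^ 3"
    by (rule reflected_seminorm_bound[where \<nu> = \<nu> and K\<^sub>0 = K\<^sub>0 and Ms = Ms and Mb = Mb]) (use assms Ms Mb \<gamma> in auto)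
  then obtain C where C: "0 \<le> C" and bound: "\<forall>x w L G. holder_bound \<alpha> 0 T L x \<longrightarrow> holder_bound \<gamma> 0 T G w \<longrightarrow>
    set_integrable lebesgue {0..T} (\<lambda>s. b s (x s)) \<longrightarrow>
    (\<forall>t\<in>{0..T}. x t = unreflected_path x0 b \<sigma> w x t + regulator (unreflected_path x0 b \<sigma> w x) t) \<longrightarrow>
    holder_seminorm \<alpha> 0 T x \<le> C * (1 + G) ^ 3" by (elim exE conjE)
  \<comment> \<open>The even order \<open>2 * k\<close> must dominate the order \<open>3 * p\<close>
    coming from the cube and also exceed Kolmogorov's threshold for \<gamma>.\<close>
  obtain k :: nat where k: "max (3 * p) (1 / (H - \<gamma>)) < real k" using reals_Archimedean2 by blast
  define q where "q = 2 * k"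
  have "1 < real k * (H - \<gamma>)" using k \<gamma> by (simp add: field_simps)
  then have kH: "2 * real k * (H - \<gamma>) > 1" by (simp add: mult.assoc)
  have q: "3 * p \<le> real q" "q > 0" using k p unfolding q_def by auto
  have "\<forall>j. \<exists>G. G \<in> borel_measurable M \<and> (\<forall>\<omega>. 0 \<le> G \<omega>) \<and> integrable M (\<lambda>\<omega>. G \<omega> ^ q) \<and>
    (AE \<omega> in M. holder_bound \<gamma> 0 T (G \<omega>) (\<lambda>t. W t \<omega> $ j))"
  proof
    fix j
    show "\<exists>G. G \<in> borel_measurable M \<and> (\<forall>\<omega>. 0 \<le> G \<omega>) \<and> integrable M (\<lambda>\<omega>. G \<omega> ^ q) \<and>
      (AE \<omega> in M. holder_bound \<gamma> 0 T (G \<omega>) (\<lambda>t. W t \<omega> $ j))"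
      unfolding q_def
    proof (rule fractional_brownian_motion_holder_moment[OF assms(1,3,6) _ _ kH])
      show "continuous_on {0..T} (\<lambda>t. W t \<omega> $ j)" if "\<omega> \<in> space M" for \<omega>
        by (rule continuous_on_component[OF assms(8)[OF that]])
    qed (use \<gamma> in simp)
  qed
  from choice[OF this] obtain G where GG: "\<forall>j. G j \<in> borel_measurable M \<and> (\<forall>\<omega>. 0 \<le> G j \<omega>) \<and>
    integrable M (\<lambda>\<omega>. G j \<omega> ^ q) \<and> (AE \<omega> in M. holder_bound \<gamma> 0 T (G j \<omega>) (\<lambda>t. W t \<omega> $ j))"
    by (elim exE)
  then have G0: "\<And>j \<omega>. 0 \<le> G j \<omega>" and Gint: "\<And>j. integrable M (\<lambda>\<omega>. G j \<omega> ^ q)"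
    and GW: "\<And>j. AE \<omega> in M. holder_bound \<gamma> 0 T (G j \<omega>) (\<lambda>t. W t \<omega> $ j)"
    by simp_all
  \<comment> \<open>Bounding the Euclidean norm by the sum of the components makes the sum of their
    constants a Hoelder constant for the vector path.\<close>
  define S where "S = (\<lambda>\<omega>. \<Sum>j\<in>UNIV. G j \<omega>)"
  have S0: "0 \<le> S \<omega>" for \<omega> unfolding S_def by (intro sum_nonneg G0)
  have SW: "holder_bound \<gamma> 0 T (S \<omega>) (\<lambda>t. W t \<omega>)" if "\<forall>j. holder_bound \<gamma> 0 T (G j \<omega>) (\<lambda>t. W t \<omega> $ j)" for \<omega>
    unfolding holder_bound_def
  proof (intro allI impI)
    fix u v assume uv: "0 \<le> u" "u \<le> v" "v \<le> T"
    have "norm (W v \<omega> - W u \<omega>) \<le> (\<Sum>j\<in>UNIV. \<bar>(W v \<omega> - W u \<omega>) $ j\<bar>)" by (rule norm_le_l1_cart)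
    also have "\<dots> \<le> (\<Sum>j\<in>UNIV. G j \<omega> * (v - u) powr \<gamma>)"
      using holder_boundD[OF that[rule_format] uv] by (intro sum_mono) simp
    finally show "norm (W v \<omega> - W u \<omega>) \<le> S \<omega> * (v - u) powr \<gamma>" by (simp add: S_def sum_distrib_right)
  qed
  define R where "R = (\<lambda>\<omega>. C powr p * (2 ^ q * (1 + real CARD('m) ^ q * (\<Sum>j\<in>UNIV. G j \<omega> ^ q))))"
  show "integrable M (\<lambda>\<omega>. holder_seminorm \<alpha> 0 T (\<lambda>t. X t \<omega>) powr p)"
  proof (rule Bochner_Integration.integrable_bound)
    show "integrable M R" unfolding R_def using Gint by (intro integrable_mult_right integrable_add integrable_sum) auto
    have X: "holder_random_variable M \<alpha> T X" using assms by (simp add: reflected_sde_solution_def)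
    have [measurable]: "(\<lambda>\<omega>. holder_seminorm \<alpha> 0 T (\<lambda>t. X t \<omega>)) \<in> borel_measurable M"
      using borel_measurable_holder_seminorm[OF _ _ X] assms by simp
    show "(\<lambda>\<omega>. holder_seminorm \<alpha> 0 T (\<lambda>t. X t \<omega>) powr p) \<in> borel_measurable M" by measurable
    have "AE \<omega> in M. \<forall>j. holder_bound \<gamma> 0 T (G j \<omega>) (\<lambda>t. W t \<omega> $ j)"
      using GW by (simp add: AE_all_countable)
    moreover have "AE \<omega> in M. set_integrable lebesgue {0..T} (\<lambda>s. b s (X s \<omega>)) \<and>
       (\<forall>t\<in>{0..T}. X t \<omega> = unreflected_path x0 b \<sigma> (\<lambda>s. W s \<omega>) (\<lambda>s. X s \<omega>) t +
         regulator (unreflected_path x0 b \<sigma> (\<lambda>s. W s \<omega>) (\<lambda>s. X s \<omega>)) t)"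
      using assms by (auto simp: reflected_sde_solution_def Let_def)
    ultimately show "AE \<omega> in M. norm (holder_seminorm \<alpha> 0 T (\<lambda>t. X t \<omega>) powr p) \<le> norm (R \<omega>)"
      using AE_space
    proof eventually_elim
      case (elim \<omega>)
      have hX: "holder_bound \<alpha> 0 T (holder_seminorm \<alpha> 0 T (\<lambda>t. X t \<omega>)) (\<lambda>t. X t \<omega>)"
        using X elim by (intro holder_bound_of_holder_space) (simp add: holder_random_variable_def)
      have "holder_seminorm \<alpha> 0 T (\<lambda>t. X t \<omega>) \<le> C * (1 + S \<omega>) ^ 3"
        using elim by (intro bound[rule_format, OF hX SW]) auto
      \<comment> \<open>Monotonicity of \<open>powr\<close> in the base needs a nonnegative
        seminorm, which follows from its being a Hoelder constant on a nondegenerate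
        interval.\<close>
      then have "holder_seminorm \<alpha> 0 T (\<lambda>t. X t \<omega>) powr p \<le> (C * (1 + S \<omega>) ^ 3) powr p"
        using holder_bound_nonneg[OF hX] assms p by (intro powr_mono2) auto
      also have "(1 + S \<omega>) ^ 3 = (1 + S \<omega>) powr 3" using S0[of \<omega>] by simp
      also have "(C * (1 + S \<omega>) powr 3) powr p = C powr p * (1 + S \<omega>) powr (3 * p)"
        using C by (simp add: powr_mult powr_powr del: powr_numeral)
      also have "\<dots> \<le> C powr p * (1 + S \<omega>) powr real q"
        using S0[of \<omega>] q by (intro mult_left_mono powr_mono) auto
      also have "(1 + S \<omega>) powr real q = (1 + S \<omega>) ^ q" using S0[of \<omega>] by (simp add: powr_realpow)
      also have "C powr p * (1 + S \<omega>) ^ q \<le> R \<omega>"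
        unfolding R_def
      proof (rule mult_left_mono)
        \<comment> \<open>Replacing \<open>1 + S\<close> by twice the maximum separates the constant
          from \<open>S ^ q\<close>, whose expectation the component moments control.\<close>
        have "(1 + S \<omega>) ^ q \<le> (2 * max 1 (S \<omega>)) ^ q" using S0[of \<omega>] by (intro power_mono) auto
        also have "\<dots> \<le> 2 ^ q * (1 + S \<omega> ^ q)"
          using S0[of \<omega>] by (simp add: power_mult_distrib max_def)
        also have "S \<omega> ^ q \<le> real CARD('m) ^ q * (\<Sum>j\<in>UNIV. G j \<omega> ^ q)"
          unfolding S_def using G0 q by (intro sum_power_le) auto
        finally show "(1 + S \<omega>) ^ q \<le> 2 ^ q * (1 + real CARD('m) ^ q * (\<Sum>j\<in>UNIV. G j \<omega> ^ q))" by simp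
      qed simp
      finally show ?case by simp
    qed
  qed
qed

end
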